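(* Let $n\ge3$ and $d\ge2$. For every $T\in\mathbb{T}_n^d$ there exists $A\in\mathbb{A}_n^d$ such that $T\circ A$ fixes every corner of the cube $n^d$ and fixes every point of the line $\ell=\{[i,0,\dots,0]: i\in[n]\}$.
   Context: Let $[n]=\{0,\dots,n-1\}$; the cube $n^d$ is $[n]^d$. A set of $n$ distinct points is a line if it can be ordered $(q^1,\dots,q^n)$ such that in each coordinate the sequence of values is strictly increasing, strictly decreasing or constant, with at least one coordinate non-constant. $\mathbb{T}_n^d$ is the group of permutations of $[n]^d$ mapping lines onto lines. Composition is written left to right: $(T\circ A)(p)=A(T(p))$. A corner is a point all of whose coordinates lie in $\{0,n-1\}$. $\mathbb{R}_d$ is the group generated by the maps $R_{ij}$ ($i\ne j$), where $R_{ij}([x_1,\dots,x_d])$ has $i$-th coordinate $n-x_j-1$, $j$-th coordinate $x_i$, and other coordinates unchanged. $\mathbb{F}_n$ is the group of maps $F_\pi([x_1,\dots,x_d])=[\pi(x_1),\dots,\pi(x_d)]$ for permutations $\pi$ of $[n]$ with $\pi(n-p-1)=n-\pi(p)-1$ for all $p$. $\mathbb{X}=\{\mathit{Id},X\}$ with $X([x_1,\dots,x_{d-1},x_d])=[x_1,\dots,x_d,x_{d-1}]$. $\mathbb{A}_n^d$ is the group generated by $\mathbb{R}_d\cup\mathbb{F}_n\cup\mathbb{X}$. *)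

theory Defs
  imports "HOL-Algebra.Bij" "HOL-Algebra.Generated_Groups" "HOL-Combinatorics.Permutations"
begin

definition cube :: "nat \<Rightarrow> nat \<Rightarrow> nat list set" where
  "cube n d = {x. length x = d \<and> set x \<subseteq> {..<n}}"

text \<open>A point $[x_1,\dots,x_d]$ is a list of length $d$, so the mathematical coordinate $x_i$ is
  the list entry at position $i - 1$. Permutations of the cube are elements of
  \<^term>\<open>Bij (cube n d)\<close>, i.e. bijections of the cube that are \<^term>\<open>undefined\<close> outside it;
  the left-to-right composite $T \circ A$ is \<^term>\<open>compose (cube n d) A T\<close>.\<close>

definition is_line :: "nat \<Rightarrow> nat \<Rightarrow> nat list set \<Rightarrow> bool" where
  "is_line n d L \<longleftrightarrow> L \<subseteq> cube n d \<and>
     (\<exists>q. bij_betw q {..<n} L \<and>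
        (\<forall>i<d. monotone_on {..<n} (<) (<) (\<lambda>k. q k ! i) \<or>
               monotone_on {..<n} (<) (>) (\<lambda>k. q k ! i) \<or>
               (\<exists>c. \<forall>k<n. q k ! i = c)) \<and>
        (\<exists>i<d. \<not> (\<exists>c. \<forall>k<n. q k ! i = c)))"

definition line_perms :: "nat \<Rightarrow> nat \<Rightarrow> (nat list \<Rightarrow> nat list) set" where
  "line_perms n d = {T \<in> Bij (cube n d). \<forall>L. is_line n d L \<longrightarrow> is_line n d (T ` L)}"

definition corners :: "nat \<Rightarrow> nat \<Rightarrow> nat list set" where
  "corners n d = {x \<in> cube n d. set x \<subseteq> {0, n - 1}}"

definition rot :: "nat \<Rightarrow> nat \<Rightarrow> nat \<Rightarrow> nat \<Rightarrow> nat list \<Rightarrow> nat list" where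
  "rot n d i j = (\<lambda>x \<in> cube n d. x[i := n - x ! j - 1, j := x ! i])"

definition rot_group :: "nat \<Rightarrow> nat \<Rightarrow> (nat list \<Rightarrow> nat list) set" where
  "rot_group n d = generate (BijGroup (cube n d)) {rot n d i j | i j. i < d \<and> j < d \<and> i \<noteq> j}"

definition coord_map :: "nat \<Rightarrow> nat \<Rightarrow> (nat \<Rightarrow> nat) \<Rightarrow> nat list \<Rightarrow> nat list" where
  "coord_map n d \<pi> = (\<lambda>x \<in> cube n d. map \<pi> x)"

definition coord_group :: "nat \<Rightarrow> nat \<Rightarrow> (nat list \<Rightarrow> nat list) set" where
  "coord_group n d = {coord_map n d \<pi> | \<pi>. \<pi> permutes {..<n} \<and>
     (\<forall>p<n. \<pi> (n - p - 1) = n - \<pi> p - 1)}"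

definition swap_last :: "nat \<Rightarrow> nat \<Rightarrow> nat list \<Rightarrow> nat list" where
  "swap_last n d = (\<lambda>x \<in> cube n d. x[d - 2 := x ! (d - 1), d - 1 := x ! (d - 2)])"

definition swap_group :: "nat \<Rightarrow> nat \<Rightarrow> (nat list \<Rightarrow> nat list) set" where
  "swap_group n d = {\<one>\<^bsub>BijGroup (cube n d)\<^esub>, swap_last n d}"

definition aut_group :: "nat \<Rightarrow> nat \<Rightarrow> (nat list \<Rightarrow> nat list) set" where
  "aut_group n d =
     generate (BijGroup (cube n d)) (rot_group n d \<union> coord_group n d \<union> swap_group n d)"

definition first_axis :: "nat \<Rightarrow> nat \<Rightarrow> nat list set" where
  "first_axis n d = {i # replicate (d - 1) 0 | i. i < n}"

text \<open>The operation \<^const>\<open>generate\<close> is only meaningful for subsets of the carrier; the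
  following facts show that all the generators are permutations of the cube.\<close>

lemma finite_cube: "finite (cube n d)"
proof -
  have "cube n d = {xs. set xs \<subseteq> {..<n} \<and> length xs = d}" by (auto simp: cube_def)
  then show ?thesis by (simp add: finite_lists_length_eq)
qed

lemma BijI_cube:
  assumes "f \<in> extensional (cube n d)" "f ` cube n d \<subseteq> cube n d" "inj_on f (cube n d)"
  shows "f \<in> Bij (cube n d)"
  using assms endo_inj_surj[OF finite_cube] by (auto simp: Bij_def bij_betw_def)

lemma cube_iff: "x \<in> cube n d \<longleftrightarrow> length x = d \<and> (\<forall>k<d. x ! k < n)"
  by (auto simp: cube_def set_conv_nth)

lemma rot_Bij:
  assumes "i < d" "j < d" "i \<noteq> j"
  shows "rot n d i j \<in> Bij (cube n d)"
proof (rule BijI_cube)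
  show "rot n d i j \<in> extensional (cube n d)" by (simp add: rot_def)
  show "rot n d i j ` cube n d \<subseteq> cube n d"
  proof
    fix y assume "y \<in> rot n d i j ` cube n d"
    then obtain x where x: "x \<in> cube n d" "y = x[i := n - x ! j - 1, j := x ! i]"
      by (auto simp: rot_def)
    have "x ! j < n" using x assms by (auto simp: cube_iff)
    then show "y \<in> cube n d" using x assms by (auto simp: cube_iff nth_list_update)
  qed
  show "inj_on (rot n d i j) (cube n d)"
  proof (rule inj_onI)
    fix x y assume x: "x \<in> cube n d" and y: "y \<in> cube n d"
      and "rot n d i j x = rot n d i j y"
    then have eq: "x[i := n - x ! j - 1, j := x ! i] = y[i := n - y ! j - 1, j := y ! i]"
      by (simp add: rot_def)
    have len: "length x = d" "length y = d" using x y by (auto simp: cube_iff)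
    have b: "x ! j < n" "y ! j < n" using x y assms by (auto simp: cube_iff)
    show "x = y"
    proof (rule nth_equalityI)
      show "length x = length y" using len by simp
      fix k assume k: "k < length x"
      have i: "x ! i = y ! i" using arg_cong[OF eq, of "\<lambda>z. z ! j"] assms len by simp
      have "n - x ! j - 1 = n - y ! j - 1"
        using arg_cong[OF eq, of "\<lambda>z. z ! i"] assms len by simp
      then have j: "x ! j = y ! j" using b by linarith
      show "x ! k = y ! k"
        using arg_cong[OF eq, of "\<lambda>z. z ! k"] i j k len
        by (cases "k = i"; cases "k = j") auto
    qed
  qed
qed

lemma coord_group_Bij: "coord_group n d \<subseteq> Bij (cube n d)"
proof
  fix f assume "f \<in> coord_group n d"
  then obtain \<pi> where f: "f = coord_map n d \<pi>" and p: "\<pi> permutes {..<n}"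
    by (auto simp: coord_group_def)
  show "f \<in> Bij (cube n d)"
  proof (rule BijI_cube)
    show "f \<in> extensional (cube n d)" by (simp add: f coord_map_def)
    have "\<pi> k < n" if "k < n" for k using permutes_in_image[OF p, of k] that by simp
    then show "f ` cube n d \<subseteq> cube n d"
      by (auto simp: f coord_map_def cube_iff)
    have "inj_on (map \<pi>) (cube n d)"
      using permutes_inj[OF p] by (rule inj_on_subset[OF inj_mapI]) simp
    then show "inj_on f (cube n d)" by (simp add: f coord_map_def)
  qed
qed

lemma swap_last_Bij:
  assumes "d \<ge> 2"
  shows "swap_last n d \<in> Bij (cube n d)"
proof (rule BijI_cube)
  show "swap_last n d \<in> extensional (cube n d)" by (simp add: swap_last_def)
  have len: "length (swap_last n d x) = d" if "x \<in> cube n d" for x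
    using that by (simp add: swap_last_def cube_iff)
  have nth: "swap_last n d x ! k =
      (if k = d - 1 then x ! (d - 2) else if k = d - 2 then x ! (d - 1) else x ! k)"
    if "x \<in> cube n d" "k < d" for x k
    using that by (simp add: swap_last_def cube_iff nth_list_update)
  have mem: "swap_last n d x \<in> cube n d" if x: "x \<in> cube n d" for x
  proof -
    have "swap_last n d x ! k < n" if "k < d" for k
      using x that assms unfolding nth[OF x that] by (simp add: cube_iff)
    then show ?thesis using len[OF x] by (simp add: cube_iff)
  qed
  show "swap_last n d ` cube n d \<subseteq> cube n d" using mem by blast
  have inv: "swap_last n d (swap_last n d x) = x" if x: "x \<in> cube n d" for x
  proof (rule nth_equalityI)
    show "length (swap_last n d (swap_last n d x)) = length x"
      using len[OF mem[OF x]] x by (simp add: cube_iff)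
    fix k assume "k < length (swap_last n d (swap_last n d x))"
    then have k: "k < d" by (simp add: len[OF mem[OF x]])
    have "d - 1 < d" "d - 2 < d" "d - 2 \<noteq> d - 1" using assms by auto
    then show "swap_last n d (swap_last n d x) ! k = x ! k"
      by (simp only: nth[OF mem[OF x] k] nth[OF x] k) auto
  qed
  show "inj_on (swap_last n d) (cube n d)" by (rule inj_on_inverseI) (rule inv)
qed

lemma rot_group_Bij: "rot_group n d \<subseteq> Bij (cube n d)"
proof -
  have "{rot n d i j | i j. i < d \<and> j < d \<and> i \<noteq> j} \<subseteq> carrier (BijGroup (cube n d))"
    using rot_Bij by (auto simp: BijGroup_def)
  from group.generate_incl[OF group_BijGroup this]
  show ?thesis by (simp add: rot_group_def BijGroup_def)
qed

lemma swap_group_Bij: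
  assumes "d \<ge> 2"
  shows "swap_group n d \<subseteq> Bij (cube n d)"
  using swap_last_Bij[OF assms] monoid.one_closed[OF group.is_monoid[OF group_BijGroup]]
  by (auto simp: swap_group_def BijGroup_def)

lemma subgroup_aut_group:
  assumes "d \<ge> 2"
  shows "subgroup (aut_group n d) (BijGroup (cube n d))"
  unfolding aut_group_def
  using rot_group_Bij coord_group_Bij swap_group_Bij[OF assms]
  by (intro group.generate_is_subgroup group_BijGroup) (simp add: BijGroup_def)

end

theory Submission
  imports Defs
begin

text \<open>
  Write \<open>opp k = n - 1 - k\<close> and call a point diagonal if all its coordinates lie in one set
  \<open>{k, opp k}\<close>; these are the points on lines along which every coordinate varies. A line
  permutation preserves diagonal points. For even \<open>n\<close> they are the points on the maximal number
  of lines. For odd \<open>n\<close> that maximum singles out the centre; among the lines through the centre, those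
  with two non-central points collinear with a given \<open>p\<close> vary exactly in the non-central
  coordinates of \<open>p\<close>, and counting them shows that diagonal points keep having no central coordinate.

  Two corners sharing a coordinate span a line that is not full, so their images have the same
  level \<open>{k, opp k}\<close>; hence all corners are sent to one level, which a coordinate map moves back to
  the corners. Adjacency of corners is an incidence property: exactly for edges no other line
  through two corners comes close to the inner points of the spanned line. Reflections and
  transpositions of coordinates then make the permutation fix the origin and its neighbours, hence
  all corners. It now preserves the first axis and both diagonals of a coordinate plane, which forces
  the induced permutation of the axis to commute with \<open>opp\<close>, so that it can be undone by
  a coordinate map.
\<close>

section \<open>Canonical parametrization of lines\<close>

lemma strict_mono_on_lessThan_eq_id:
  fixes f :: "nat \<Rightarrow> nat"
  assumes mono: "monotone_on {..<n} (<) (<) f" and less: "\<And>k. k < n \<Longrightarrow> f k < n" and k: "k < n"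
  shows "f k = k"
proof -
  \<comment> \<open>Strict growth gains at least 1 per step: from \<open>k\<close> up to
    \<open>n - 1\<close> this bounds \<open>f k\<close> above by \<open>k\<close>, from
    \<open>0\<close> up to \<open>k\<close> it bounds it below.\<close>
  have step: "f k + m \<le> f (k + m)" if "k + m < n" for k m
    using that
  proof (induction m)
    case (Suc m)
    have "f (k + m) < f (k + Suc m)"
      using Suc.prems by (intro monotone_onD[OF mono]) auto
    with Suc show ?case by simp
  qed simp
  have "f k + (n - 1 - k) \<le> f (n - 1)" using step[of k "n - 1 - k"] k by simp
  moreover have "f (n - 1) < n" using less k by simp
  ultimately have "f k \<le> k" using k by linarith
  moreover have "k \<le> f k" using step[of 0 k] k by simp
  ultimately show ?thesis by simp
qed

lemma strict_antimono_on_lessThan_eq: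
  fixes f :: "nat \<Rightarrow> nat"
  assumes anti: "monotone_on {..<n} (<) (>) f" and less: "\<And>k. k < n \<Longrightarrow> f k < n" and k: "k < n"
  shows "f k = n - 1 - k"
proof -
  have "monotone_on {..<n} (<) (<) (\<lambda>k. n - 1 - f k)"
  proof (rule monotone_onI)
    fix i j assume "i \<in> {..<n}" "j \<in> {..<n}" "i < j"
    then have "f j < f i" "f i < n" using monotone_onD[OF anti] less by auto
    then show "n - 1 - f i < n - 1 - f j" by linarith
  qed
  from strict_mono_on_lessThan_eq_id[OF this _ k] have "n - 1 - f k = k" using k by auto
  then show ?thesis using less[OF k] by linarith
qed

locale cube_lines =
  fixes n d :: nat
  assumes n3: "n \<ge> 3" and d2: "d \<ge> 2"
begin

abbreviation Q where "Q \<equiv> cube n d"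
abbreviation line where "line \<equiv> is_line n d"

definition opp :: "nat \<Rightarrow> nat" where "opp k = n - 1 - k"

text \<open>The coordinates that vary along the line. Reading them off the point set avoids choosing
  one of the two orientations of a line.\<close>

definition supp :: "nat list set \<Rightarrow> nat set" where
  "supp L = {i. i < d \<and> (\<exists>y\<in>L. \<exists>z\<in>L. y ! i \<noteq> z ! i)}"

lemma opp_less [simp]: "opp k < n" using n3 by (simp add: opp_def)
lemma opp_opp [simp]: "k < n \<Longrightarrow> opp (opp k) = k" by (simp add: opp_def)
lemma opp_inj: "k < n \<Longrightarrow> l < n \<Longrightarrow> opp k = opp l \<longleftrightarrow> k = l" by (auto simp: opp_def)
lemma opp_eq_iff: "k < n \<Longrightarrow> l < n \<Longrightarrow> opp k = l \<longleftrightarrow> k = opp l" by (auto simp: opp_def)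

lemma cube_nth: "x \<in> Q \<Longrightarrow> i < d \<Longrightarrow> x ! i < n" by (simp add: cube_iff)
lemma cube_eqI: "x \<in> Q \<Longrightarrow> y \<in> Q \<Longrightarrow> (\<And>i. i < d \<Longrightarrow> x ! i = y ! i) \<Longrightarrow> x = y"
  by (auto simp: cube_iff intro: nth_equalityI)
lemma cube_neqE:
  assumes "x \<in> Q" "y \<in> Q" "x \<noteq> y" obtains i where "i < d" "x ! i \<noteq> y ! i"
  using assms cube_eqI by blast
lemma tab_cube: "(\<And>i. i < d \<Longrightarrow> f i < n) \<Longrightarrow> map f [0..<d] \<in> Q" by (simp add: cube_iff)

lemma cube_update: "x \<in> Q \<Longrightarrow> v < n \<Longrightarrow> x[i := v] \<in> Q"
  using set_update_subset_insert[of x i v] by (auto simp: cube_def)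

text \<open>Taking \<open>n\<close> strictly monotone values in \<open>{..<n}\<close> leaves no
  freedom: a varying coordinate runs through all values, upwards or downwards.\<close>

lemma line_param:
  assumes "line L"
  obtains q where "L = q ` {..<n}" "\<And>k. k < n \<Longrightarrow> q k \<in> Q"
    "\<And>i. i < d \<Longrightarrow> (\<forall>k<n. q k ! i = k) \<or> (\<forall>k<n. q k ! i = opp k) \<or> (\<exists>c. \<forall>k<n. q k ! i = c)"
    "\<exists>i<d. \<not> (\<exists>c. \<forall>k<n. q k ! i = c)"
proof -
  from assms obtain q where L: "L \<subseteq> Q" and q: "bij_betw q {..<n} L"
    and mono: "\<And>i. i < d \<Longrightarrow> monotone_on {..<n} (<) (<) (\<lambda>k. q k ! i) \<or>
               monotone_on {..<n} (<) (>) (\<lambda>k. q k ! i) \<or> (\<exists>c. \<forall>k<n. q k ! i = c)"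
    and ne: "\<exists>i<d. \<not> (\<exists>c. \<forall>k<n. q k ! i = c)"
    unfolding is_line_def by blast
  have im: "L = q ` {..<n}" using q by (simp add: bij_betw_def)
  then have Q: "q k \<in> Q" if "k < n" for k using L that by auto
  have "(\<forall>k<n. q k ! i = k) \<or> (\<forall>k<n. q k ! i = opp k) \<or> (\<exists>c. \<forall>k<n. q k ! i = c)" if i: "i < d" for i
    using mono[OF i] strict_mono_on_lessThan_eq_id[of n "\<lambda>k. q k ! i"]
      strict_antimono_on_lessThan_eq[of n "\<lambda>k. q k ! i"] cube_nth[OF Q i]
    unfolding opp_def by blast
  with im Q ne show ?thesis using that by blast
qed

lemma line_subset: "line L \<Longrightarrow> L \<subseteq> Q" by (simp add: is_line_def)
lemma line_in_cube: "line L \<Longrightarrow> x \<in> L \<Longrightarrow> x \<in> Q" using line_subset by blast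

lemma supp_less: "i \<in> supp L \<Longrightarrow> i < d" by (simp add: supp_def)

lemma suppI: "i < d \<Longrightarrow> x \<in> L \<Longrightarrow> y \<in> L \<Longrightarrow> x ! i \<noteq> y ! i \<Longrightarrow> i \<in> supp L"
  by (auto simp: supp_def)

lemma supp_const: "i < d \<Longrightarrow> i \<notin> supp L \<Longrightarrow> x \<in> L \<Longrightarrow> y \<in> L \<Longrightarrow> x ! i = y ! i"
  unfolding supp_def by blast

lemma line_supp_nonempty: assumes "line L" obtains i where "i \<in> supp L"
proof -
  obtain q i where q: "L = q ` {..<n}" "i < d" "\<not> (\<exists>c. \<forall>k<n. q k ! i = c)"
    by (rule line_param[OF assms]) blast
  then obtain k where "k < n" "q k ! i \<noteq> q 0 ! i" by blast
  then have "i \<in> supp L" using q n3 by (intro suppI[of i "q k" L "q 0"]) auto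
  then show ?thesis using that by blast
qed

lemma line_param_supp:
  assumes "line L" and i: "i \<in> supp L"
  shows "\<exists>q. L = q ` {..<n} \<and> (\<forall>k<n. q k ! i = k) \<and>
    (\<forall>j\<in>supp L. (\<forall>k<n. q k ! j = k) \<or> (\<forall>k<n. q k ! j = opp k))"
proof -
  obtain q where q: "L = q ` {..<n}"
    "\<And>i. i < d \<Longrightarrow> (\<forall>k<n. q k ! i = k) \<or> (\<forall>k<n. q k ! i = opp k) \<or> (\<exists>c. \<forall>k<n. q k ! i = c)"
    by (rule line_param[OF assms(1)]) blast
  have S: "(\<forall>k<n. q k ! j = k) \<or> (\<forall>k<n. q k ! j = opp k)" if "j \<in> supp L" for j
  proof -
    have "\<not> (\<exists>c. \<forall>k<n. q k ! j = c)" using that unfolding supp_def q(1) by force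
    then show ?thesis using q(2)[of j] that supp_less by blast
  qed
  show ?thesis
  proof (cases "\<forall>k<n. q k ! i = k")
    case True then show ?thesis using q(1) S by blast
  next
    case False
    then have o: "\<forall>k<n. q k ! i = opp k" using S[OF i] by blast
    \<comment> \<open>Coordinate \<open>i\<close> runs downwards, so the line is traversed
      backwards; this exchanges the two directions at every other active coordinate.\<close>
    have "opp ` {..<n} = {..<n}"
      by (auto simp: image_iff) (metis lessThan_iff opp_less opp_opp)
    then have "L = (\<lambda>k. q (opp k)) ` {..<n}" unfolding q(1) by (metis image_image)
    moreover have "(\<forall>k<n. q (opp k) ! j = k) \<or> (\<forall>k<n. q (opp k) ! j = opp k)" if "j \<in> supp L" for j
      using S[OF that] by force
    ultimately show ?thesis using o by (intro exI[of _ "\<lambda>k. q (opp k)"]) simp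
  qed
qed

lemma line_dir:
  assumes "line L" "i \<in> supp L" "j \<in> supp L"
  shows "(\<forall>z\<in>L. z ! j = z ! i) \<or> (\<forall>z\<in>L. z ! j = opp (z ! i))"
proof -
  obtain q where q: "L = q ` {..<n}" "\<forall>k<n. q k ! i = k"
    "(\<forall>k<n. q k ! j = k) \<or> (\<forall>k<n. q k ! j = opp k)"
    using line_param_supp[OF assms(1,2)] assms(3) by blast
  then show ?thesis by auto
qed

lemma line_inj:
  assumes "line L" "i \<in> supp L" "x \<in> L" "y \<in> L" "x ! i = y ! i"
  shows "x = y"
proof -
  obtain q where "L = q ` {..<n}" "\<forall>k<n. q k ! i = k"
    using line_param_supp[OF assms(1,2)] by blast
  then show ?thesis using assms(3-) by auto
qed

lemma line_ex:
  assumes "line L" "i \<in> supp L" "k < n"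
  obtains z where "z \<in> L" "z ! i = k"
proof -
  obtain q where "L = q ` {..<n}" "\<forall>k<n. q k ! i = k"
    using line_param_supp[OF assms(1,2)] by blast
  then show ?thesis using assms(3) that[of "q k"] by auto
qed

lemma line_coord:
  assumes "line L" "i \<in> supp L" "j \<in> supp L" "z \<in> L"
  shows "z ! j = z ! i \<or> z ! j = opp (z ! i)"
  using line_dir[OF assms(1-3)] assms(4) by blast

lemma lineI:
  assumes Q: "\<And>k. k < n \<Longrightarrow> q k \<in> Q"
    and coord: "\<And>i. i < d \<Longrightarrow>
      (\<forall>k<n. q k ! i = k) \<or> (\<forall>k<n. q k ! i = opp k) \<or> (\<exists>c. \<forall>k<n. q k ! i = c)"
    and i: "i < d" and nonconst: "\<not> (\<exists>c. \<forall>k<n. q k ! i = c)"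
  shows "line (q ` {..<n})"
proof -
  have "inj_on q {..<n}"
  proof (rule inj_onI)
    fix a b assume *: "a \<in> {..<n}" "b \<in> {..<n}" "q a = q b"
    have "q a ! i = q b ! i" using *(3) by simp
    then show "a = b" using *(1,2) coord[OF i] nonconst opp_inj by auto
  qed
  then have "bij_betw q {..<n} (q ` {..<n})" by (rule inj_on_imp_bij_betw)
  moreover have "monotone_on {..<n} (<) (<) (\<lambda>k. q k ! i) \<or>
               monotone_on {..<n} (<) (>) (\<lambda>k. q k ! i) \<or>
               (\<exists>c. \<forall>k<n. q k ! i = c)" if "i < d" for i
    using coord[OF that] by (auto simp: monotone_on_def opp_def)
  ultimately show ?thesis
    unfolding is_line_def using Q i nonconst by blast
qed

text \<open>Directions are read off \<open>x\<close>: coordinates in \<open>S\<close> with value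
  \<open>k\<close> move with the parameter, the others against it. The last clause exhibits the
  remaining points, so that a second prescribed point, such as the centre, can be located on the
  line.\<close>

lemma line_through:
  assumes x: "x \<in> Q" and S: "S \<subseteq> {..<d}" "S \<noteq> {}" and k: "k < n"
    and xS: "\<And>i. i \<in> S \<Longrightarrow> x ! i = k \<or> x ! i = opp k"
  obtains L where "line L" "x \<in> L" "supp L = S"
    "\<And>l. l < n \<Longrightarrow> map (\<lambda>i. if i \<in> S then if x ! i = k then l else opp l else x ! i) [0..<d] \<in> L"
proof -
  define q where "q l = map (\<lambda>i. if i \<in> S then if x ! i = k then l else opp l else x ! i) [0..<d]" for l
  have nth: "q l ! i = (if i \<in> S then if x ! i = k then l else opp l else x ! i)" if "i < d" for i l
    using that by (simp add: q_def)
  have Q: "q l \<in> Q" if "l < n" for l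
    unfolding q_def using that cube_nth[OF x] by (intro tab_cube) auto
  have xq: "x = q k"
    using x xS Q[OF k] by (intro cube_eqI) (auto simp: nth)
  have nc: "q 0 ! i \<noteq> q 1 ! i" if "i \<in> S" for i
  proof -
    have "i < d" using S that by blast
    then show ?thesis using that n3 by (auto simp: nth opp_def)
  qed
  obtain i where i: "i \<in> S" "i < d" using S by blast
  have "0 < n" "1 < n" using n3 by auto
  then have "\<not> (\<exists>c. \<forall>k<n. q k ! i = c)" using nc[OF i(1)] i(2) by metis
  then have "line (q ` {..<n})"
    using i by (intro lineI[of q i] Q) (auto simp: nth)
  moreover have "supp (q ` {..<n}) = S"
  proof
    show "supp (q ` {..<n}) \<subseteq> S" by (auto simp: supp_def nth split: if_splits)
    show "S \<subseteq> supp (q ` {..<n})"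
      using nc S n3 by (fastforce intro: suppI[of _ "q 0" _ "q 1"])
  qed
  ultimately show ?thesis using that[of "q ` {..<n}"] xq k by (simp flip: q_def)
qed

text \<open>Criterion for maps that fix, copy or reflect coordinates along a line. It serves
  projections, extensions of lines to full lines and signed coordinate permutations.\<close>

lemma line_image_coords:
  assumes L: "line L" and Q: "\<And>y. y \<in> L \<Longrightarrow> f y \<in> Q"
    and coord: "\<And>i. i < d \<Longrightarrow> (\<exists>c. \<forall>y\<in>L. f y ! i = c) \<or>
      (\<exists>j\<in>supp L. (\<forall>y\<in>L. f y ! i = y ! j) \<or> (\<forall>y\<in>L. f y ! i = opp (y ! j)))"
    and i: "i < d" and nonconst: "\<not> (\<exists>c. \<forall>y\<in>L. f y ! i = c)"
  shows "line (f ` L)"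
proof -
  obtain j0 where j0: "j0 \<in> supp L" using line_supp_nonempty[OF L] .
  obtain q where q: "L = q ` {..<n}"
    "\<And>j. j \<in> supp L \<Longrightarrow> (\<forall>k<n. q k ! j = k) \<or> (\<forall>k<n. q k ! j = opp k)"
    using line_param_supp[OF L j0] by blast
  have "line ((\<lambda>k. f (q k)) ` {..<n})"
  proof (rule lineI[where i = i])
    fix a assume a: "a < d"
    show "(\<forall>k<n. f (q k) ! a = k) \<or> (\<forall>k<n. f (q k) ! a = opp k) \<or> (\<exists>c. \<forall>k<n. f (q k) ! a = c)"
    proof (cases "\<exists>c. \<forall>y\<in>L. f y ! a = c")
      case True then show ?thesis using q(1) by blast
    next
      case False
      then obtain j where j: "j \<in> supp L"
        "(\<forall>y\<in>L. f y ! a = y ! j) \<or> (\<forall>y\<in>L. f y ! a = opp (y ! j))" using coord[OF a] by blast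
      then show ?thesis using q(2)[OF j(1)] unfolding q(1) by fastforce
    qed
  qed (use Q i nonconst q(1) in auto)
  then show ?thesis by (simp add: q(1) image_image)
qed

text \<open>A coordinate is active exactly where \<open>x\<close> and \<open>y\<close> differ, and
  the two points also settle which active coordinates run in the same direction, so a point of
  either line is determined by one active coordinate.\<close>

lemma line_unique:
  assumes L: "line L" and L': "line L'" and xy: "x \<noteq> y"
    and xL: "x \<in> L" and yL: "y \<in> L" and xL': "x \<in> L'" and yL': "y \<in> L'"
  shows "L = L'"
proof -
  have "A \<subseteq> B" if A: "line A" "x \<in> A" "y \<in> A" and B: "line B" "x \<in> B" "y \<in> B" for A B
  proof
    fix z assume z: "z \<in> A"
    obtain i where i: "i < d" "x ! i \<noteq> y ! i"
      using cube_neqE[OF line_in_cube[OF L xL] line_in_cube[OF L yL] xy] by blast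
    have iA: "i \<in> supp A" and iB: "i \<in> supp B" using suppI[OF i(1)] i(2) A B by blast+
    obtain w where w: "w \<in> B" "w ! i = z ! i"
      using line_ex[OF B(1) iB] cube_nth[OF line_in_cube[OF A(1) z] i(1)] by blast
    have "z = w"
    proof (rule cube_eqI)
      show "z \<in> Q" "w \<in> Q" using A B z w line_in_cube by blast+
      fix j assume j: "j < d"
      show "z ! j = w ! j"
      proof (cases "x ! j = y ! j")
        case True
        then have "j \<notin> supp A" "j \<notin> supp B" using line_inj A B xy by blast+
        then show ?thesis using supp_const[OF j] A(2) B(2) z w by metis
      next
        case False
        then have jA: "j \<in> supp A" and jB: "j \<in> supp B" using suppI[OF j] A B by blast+
        \<comment> \<open>At most one value is self-opposite, so at \<open>x\<close> or at
          \<open>y\<close> running with \<open>i\<close> can be told from running against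
          \<open>i\<close>.\<close>
        have "\<not> (x ! i = opp (x ! i) \<and> y ! i = opp (y ! i))"
          using i(2) cube_nth[OF line_in_cube[OF L xL] i(1)] cube_nth[OF line_in_cube[OF L yL] i(1)]
          unfolding opp_def by linarith
        moreover have "z ! j = z ! i \<and> x ! j = x ! i \<and> y ! j = y ! i \<or>
            z ! j = opp (z ! i) \<and> x ! j = opp (x ! i) \<and> y ! j = opp (y ! i)"
          using line_dir[OF A(1) iA jA] A z by blast
        moreover have "w ! j = w ! i \<and> x ! j = x ! i \<and> y ! j = y ! i \<or>
            w ! j = opp (w ! i) \<and> x ! j = opp (x ! i) \<and> y ! j = opp (y ! i)"
          using line_dir[OF B(1) iB jB] B w by blast
        ultimately show ?thesis using w(2) by metis
      qed
    qed
    then show "z \<in> B" using w by simp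
  qed
  then show ?thesis using assms by (intro equalityI) blast+
qed

section \<open>Collinearity in coordinates\<close>

definition col :: "nat list \<Rightarrow> nat list \<Rightarrow> bool" where
  "col x y \<longleftrightarrow> x = y \<or> (\<exists>L. line L \<and> x \<in> L \<and> y \<in> L)"

text \<open>Along the joining line, moving one active coordinate from \<open>k\<close> to
  \<open>l\<close> moves each other active one in the same way or by the reflected change. With
  \<open>colI\<close> this turns collinearity into a coordinatewise test.\<close>

lemma col_coords:
  assumes "col x y" "x \<in> Q" "y \<in> Q"
  shows "\<exists>k<n. \<exists>l<n. k \<noteq> l \<and>
    (\<forall>i<d. x ! i = y ! i \<or> x ! i = k \<and> y ! i = l \<or> x ! i = opp k \<and> y ! i = opp l)"
proof (cases "x = y")
  case True then show ?thesis using n3 by (intro exI[of _ 0] conjI exI[of _ 1]) auto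
next
  case False
  then obtain L where L: "line L" "x \<in> L" "y \<in> L" using assms by (auto simp: col_def)
  obtain i where i: "i < d" "x ! i \<noteq> y ! i" using cube_neqE assms False by blast
  have iL: "i \<in> supp L" using suppI i L by blast
  have "x ! j = y ! j \<or> x ! j = x ! i \<and> y ! j = y ! i \<or> x ! j = opp (x ! i) \<and> y ! j = opp (y ! i)"
    if j: "j < d" for j
  proof (cases "j \<in> supp L")
    case True then show ?thesis using line_dir[OF L(1) iL True] L by blast
  next
    case False then show ?thesis using supp_const[OF j False] L by blast
  qed
  moreover have "x ! i < n" "y ! i < n" using i assms cube_nth by auto
  ultimately show ?thesis using i(2) by blast
qed

lemma col_sym: "col x y \<Longrightarrow> col y x" unfolding col_def by blast

lemma colI_aux:
  assumes "x \<in> Q" "y \<in> Q" "k < n" "l < n" and k: "k \<noteq> opp k"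
    and xy: "\<And>i. i < d \<Longrightarrow> x ! i = y ! i \<or> x ! i = k \<and> y ! i = l \<or> x ! i = opp k \<and> y ! i = opp l"
  shows "col x y"
proof (cases "x = y")
  case False
  define S where "S = {i. i < d \<and> x ! i \<noteq> y ! i}"
  obtain L where L: "line L" "x \<in> L" 
    "\<And>l. l < n \<Longrightarrow> map (\<lambda>i. if i \<in> S then if x ! i = k then l else opp l else x ! i) [0..<d] \<in> L"
  proof (rule line_through[of x S k])
    show "S \<noteq> {}" using False cube_neqE assms unfolding S_def by blast
  qed (use assms in \<open>auto simp: S_def\<close>)
  have "y = map (\<lambda>i. if i \<in> S then if x ! i = k then l else opp l else x ! i) [0..<d]"
  proof (rule cube_eqI)
    show m: "map (\<lambda>i. if i \<in> S then if x ! i = k then l else opp l else x ! i) [0..<d] \<in> Q"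
      using L line_in_cube assms by blast
    fix i assume i: "i < d"
    show "y ! i = map (\<lambda>i. if i \<in> S then if x ! i = k then l else opp l else x ! i) [0..<d] ! i"
      using k xy[OF i] i by (auto simp: S_def)
  qed fact
  then show ?thesis using L assms unfolding col_def by metis
qed (simp add: col_def)

text \<open>The line is built from an endpoint that shows the directions, which fails only at a
  self-opposite value. If \<open>k\<close> is self-opposite, the roles of \<open>x\<close> and
  \<open>y\<close> are exchanged; if \<open>l\<close> is as well, then \<open>k = l\<close> and the
  points coincide.\<close>

lemma colI:
  assumes "x \<in> Q" "y \<in> Q" "k < n" "l < n"
    and xy: "\<And>i. i < d \<Longrightarrow> x ! i = y ! i \<or> x ! i = k \<and> y ! i = l \<or> x ! i = opp k \<and> y ! i = opp l"
  shows "col x y"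
proof (cases "k = opp k")
  case False then show ?thesis using colI_aux[of x y k l] assms by blast
next
  case k: True
  show ?thesis
  proof (cases "l = opp l")
    case False
    then show ?thesis using assms by (intro col_sym[OF colI_aux[of y x l k]]) metis+
  next
    case True
    then have "k = l" using k assms(3,4) unfolding opp_def by linarith
    then have "x ! i = y ! i" if "i < d" for i using xy[OF that] by auto
    then have "x = y" using cube_eqI assms(1,2) by blast
    then show ?thesis by (simp add: col_def)
  qed
qed

section \<open>Line permutations and their inverses\<close>

abbreviation LP where "LP \<equiv> line_perms n d"

lemma LP_in_cube: "T \<in> LP \<Longrightarrow> x \<in> Q \<Longrightarrow> T x \<in> Q"
  by (auto simp: line_perms_def Bij_def bij_betw_def)

lemma LP_inj_on: "T \<in> LP \<Longrightarrow> inj_on T Q"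
  by (auto simp: line_perms_def Bij_def bij_betw_def)

lemma LP_eq_iff: "T \<in> LP \<Longrightarrow> x \<in> Q \<Longrightarrow> y \<in> Q \<Longrightarrow> T x = T y \<longleftrightarrow> x = y"
  using LP_inj_on by (auto simp: inj_on_def)

lemma LP_line: "T \<in> LP \<Longrightarrow> line L \<Longrightarrow> line (T ` L)"
  by (simp add: line_perms_def)

lemma finite_lines: "finite {L. line L}"
  by (rule finite_subset[of _ "Pow Q"]) (auto simp: finite_cube dest: line_in_cube)

lemma LP_inj_on_lines: "T \<in> LP \<Longrightarrow> inj_on ((`) T) {L. line L}"
  by (rule inj_on_image, rule inj_on_subset[OF LP_inj_on]) (auto dest: line_in_cube)

text \<open>Taking images is an injective self-map of the finite set of lines, hence onto. So every
  line is the image of a line, and the inverse permutation preserves lines too.\<close>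

lemma LP_inverse:
  assumes T: "T \<in> LP"
  obtains S where "S \<in> LP" "\<And>x. x \<in> Q \<Longrightarrow> S (T x) = x" "\<And>x. x \<in> Q \<Longrightarrow> T (S x) = x"
proof -
  define S where "S = (\<lambda>x\<in>Q. inv_into Q T x)"
  have B: "T \<in> Bij Q" using T by (simp add: line_perms_def)
  then have im: "T ` Q = Q" by (simp add: Bij_def bij_betw_def)
  have ST: "S (T x) = x" if "x \<in> Q" for x
    using that LP_in_cube[OF T] LP_inj_on[OF T] by (simp add: S_def)
  have TS: "T (S x) = x" if "x \<in> Q" for x
    using that im by (simp add: S_def f_inv_into_f)
  have surj: "(`) T ` {L. line L} = {L. line L}"
    using LP_line[OF T] by (intro endo_inj_surj finite_lines LP_inj_on_lines[OF T]) auto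
  have "line (S ` L)" if "line L" for L
  proof -
    obtain L' where L': "line L'" "L = T ` L'" using surj \<open>line L\<close> by blast
    then have "S ` L = L'" using ST line_in_cube by (force simp: image_image)
    then show ?thesis using L' by simp
  qed
  then have "S \<in> LP"
    unfolding line_perms_def S_def using restrict_inv_into_Bij[OF B] by blast
  then show ?thesis using that ST TS by blast
qed

lemma LP_col: "T \<in> LP \<Longrightarrow> col x y \<Longrightarrow> col (T x) (T y)"
  unfolding col_def using LP_line by blast

lemma supp_nonempty: "line L \<Longrightarrow> supp L \<noteq> {}"
  using line_supp_nonempty by blast

subsection \<open>Diagonal points\<close>

definition pencil :: "nat list \<Rightarrow> nat list set set" where
  "pencil x = {L. line L \<and> x \<in> L}"

lemma finite_pencil: "finite (pencil x)"
  by (rule finite_subset[OF _ finite_lines]) (auto simp: pencil_def)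

lemma LP_card_pencil_le:
  assumes "T \<in> LP"
  shows "card (pencil x) \<le> card (pencil (T x))"
proof (rule card_inj_on_le)
  show "inj_on ((`) T) (pencil x)"
    by (rule inj_on_subset[OF LP_inj_on_lines[OF assms]]) (auto simp: pencil_def)
qed (use LP_line[OF assms] finite_pencil in \<open>auto simp: pencil_def\<close>)

definition diag :: "nat list \<Rightarrow> bool" where
  "diag x \<longleftrightarrow> x \<in> Q \<and> (\<forall>i<d. \<forall>j<d. x ! j = x ! i \<or> x ! j = opp (x ! i))"

lemma diag_line_through:
  assumes x: "diag x" and S: "S \<subseteq> {..<d}" "S \<noteq> {}"
  obtains L where "line L" "x \<in> L" "supp L = S"
proof -
  obtain i where i: "i \<in> S" "i < d" using S by blast
  have xQ: "x \<in> Q" using x by (simp add: diag_def)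
  show ?thesis
  proof (rule line_through[OF xQ S cube_nth[OF xQ i(2)]])
    show "x ! j = x ! i \<or> x ! j = opp (x ! i)" if "j \<in> S" for j
      using x i(2) that S unfolding diag_def by blast
  qed (use that in blast)
qed

lemma full_line_diag:
  assumes "line L" "supp L = {..<d}" "x \<in> L"
  shows "diag x"
  using line_coord[OF assms(1)] assms line_in_cube by (simp add: diag_def)

text \<open>If coordinate \<open>j\<close> is constant, an active coordinate takes a value outside
  \<open>{z ! j, opp (z ! j)}\<close>, since \<open>n\<close> is at least 3, and that point is not
  diagonal. Full lines are thus recognized by their points.\<close>

lemma diag_line_full:
  assumes L: "line L" and D: "\<And>x. x \<in> L \<Longrightarrow> diag x"
  shows "supp L = {..<d}"
proof (rule ccontr)
  assume "supp L \<noteq> {..<d}"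
  then obtain j where j: "j < d" "j \<notin> supp L" using supp_less by blast
  obtain i where i: "i \<in> supp L" using line_supp_nonempty[OF L] .
  obtain z where z: "z \<in> L" using line_ex[OF L i, of 0] n3 by auto
  have "\<exists>m<n. m \<noteq> z ! j \<and> m \<noteq> opp (z ! j)"
  proof -
    have "card {z ! j, opp (z ! j)} < card {..<n}" using n3 by (simp add: card_insert_if)
    then have "\<not> {..<n} \<subseteq> {z ! j, opp (z ! j)}" using card_mono[of "{z ! j, opp (z ! j)}" "{..<n}"] by auto
    then show ?thesis by auto
  qed
  then obtain m where m: "m < n" "m \<noteq> z ! j" "m \<noteq> opp (z ! j)" by blast
  obtain y where y: "y \<in> L" "y ! i = m" using line_ex[OF L i m(1)] .
  have "y ! j = z ! j" using supp_const[OF j y(1) z] .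
  then show False using D[OF y(1)] m y(2) j(1) supp_less[OF i] unfolding diag_def by metis
qed

text \<open>Since no coordinate of \<open>x\<close> is self-opposite, \<open>x\<close> itself shows
  which active coordinates run together. Hence the active set determines a line through
  \<open>x\<close>, and there are at most as many lines as nonempty coordinate sets.\<close>

lemma inj_on_supp_pencil:
  assumes x: "\<And>i. i < d \<Longrightarrow> opp (x ! i) \<noteq> x ! i"
  shows "inj_on supp (pencil x)"
proof (rule inj_onI)
  fix L L' assume *: "L \<in> pencil x" "L' \<in> pencil x" and S: "supp L = supp L'"
  then have L: "line L" "x \<in> L" and L': "line L'" "x \<in> L'" by (auto simp: pencil_def)
  obtain i where i: "i \<in> supp L" using line_supp_nonempty[OF L(1)] .
  have "\<exists>k<n. k \<noteq> x ! i" using n3 by (intro exI[of _ "if x ! i = 0 then 1 else 0"]) auto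
  then obtain k where k: "k < n" "k \<noteq> x ! i" by blast
  obtain y where y: "y \<in> L" "y ! i = k" using line_ex[OF L(1) i k(1)] .
  obtain y' where y': "y' \<in> L'" "y' ! i = k" using line_ex[OF L'(1) i[unfolded S] k(1)] .
  have "y = y'"
  proof (rule cube_eqI)
    fix j assume j: "j < d"
    show "y ! j = y' ! j"
    proof (cases "j \<in> supp L")
      case True
      have "y ! j = y ! i \<and> x ! j = x ! i \<or> y ! j = opp (y ! i) \<and> x ! j = opp (x ! i)"
        using line_dir[OF L(1) i True] L y by blast
      moreover have "y' ! j = y' ! i \<and> x ! j = x ! i \<or> y' ! j = opp (y' ! i) \<and> x ! j = opp (x ! i)"
        using line_dir[OF L'(1), of i j] i True S L' y' by blast
      ultimately show ?thesis using x[OF supp_less[OF i]] y(2) y'(2) by metis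
    next
      case False
      then show ?thesis using supp_const[OF j] y(1) y'(1) L L' S by metis
    qed
  qed (use L L' y y' line_in_cube in blast)+
  then show "L = L'" using line_unique[OF L(1) L'(1), of x y] L L' y y' k by auto
qed

text \<open>A diagonal point has a line for every nonempty coordinate set, the largest possible
  number. Its image lies on at least as many lines, so every set occurs there too, in particular
  \<open>{..<d}\<close>, and a full line consists of diagonal points.\<close>

lemma LP_diag_even:
  assumes T: "T \<in> LP" and even: "\<And>k. k < n \<Longrightarrow> opp k \<noteq> k" and x: "diag x"
  shows "diag (T x)"
proof -
  have xQ: "x \<in> Q" using x by (simp add: diag_def)
  let ?P = "Pow {..<d} - {{}}"
  have sub: "supp ` pencil y \<subseteq> ?P" for y
    using supp_nonempty supp_less by (auto simp: pencil_def)
  have inj: "inj_on supp (pencil y)" if "y \<in> Q" for y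
    using inj_on_supp_pencil even cube_nth[OF that] by blast
  have "?P \<subseteq> supp ` pencil x"
  proof
    fix S assume "S \<in> ?P"
    then obtain L where "line L" "x \<in> L" "supp L = S" using diag_line_through[OF x, of S] by auto
    then show "S \<in> supp ` pencil x" by (auto simp: pencil_def)
  qed
  then have "card ?P \<le> card (pencil x)"
    using card_mono[OF finite_imageI[OF finite_pencil]] card_image[OF inj[OF xQ]] by metis
  also have "\<dots> \<le> card (pencil (T x))" by (rule LP_card_pencil_le[OF T])
  also have "\<dots> = card (supp ` pencil (T x))" using card_image[OF inj[OF LP_in_cube[OF T xQ]]] by simp
  finally have "supp ` pencil (T x) = ?P" using sub by (intro card_seteq) auto
  moreover have "{..<d} \<in> ?P" using d2 by (auto simp: lessThan_empty_iff)
  ultimately have "{..<d} \<in> supp ` pencil (T x)" by simp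
  then obtain L where "L \<in> pencil (T x)" "supp L = {..<d}" by (metis imageE)
  then show ?thesis using full_line_diag by (auto simp: pencil_def)
qed

section \<open>The centre of a cube with odd side length\<close>

definition proj :: "nat \<Rightarrow> nat set \<Rightarrow> nat list \<Rightarrow> nat list" where
  "proj h S y = map (\<lambda>i. if i \<in> S then y ! i else h) [0..<d]"

lemma proj_nth: "i < d \<Longrightarrow> proj h S y ! i = (if i \<in> S then y ! i else h)"
  by (simp add: proj_def)

text \<open>Projecting turns every line into a line through the centre \<open>[h, \<dots>, h]\<close> with the same
  varying coordinates, which makes the centre the point on the largest number of lines.\<close>

lemma proj_line:
  assumes L: "line L" and h: "h < n" "opp h = h"
  shows "line (proj h (supp L) ` L)" "supp (proj h (supp L) ` L) = supp L"
    "replicate d h \<in> proj h (supp L) ` L"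
proof -
  have Q: "proj h (supp L) y \<in> Q" if "y \<in> L" for y
    unfolding proj_def using cube_nth[OF line_in_cube[OF L that]] h by (intro tab_cube) auto
  show supp: "supp (proj h (supp L) ` L) = supp L"
  proof
    show "supp (proj h (supp L) ` L) \<subseteq> supp L"
    proof
      fix i assume "i \<in> supp (proj h (supp L) ` L)"
      then obtain y z where "i < d" "proj h (supp L) y ! i \<noteq> proj h (supp L) z ! i"
        unfolding supp_def by blast
      then show "i \<in> supp L" by (metis proj_nth)
    qed
    show "supp L \<subseteq> supp (proj h (supp L) ` L)"
    proof
      fix i assume i: "i \<in> supp L"
      then obtain y z where "i < d" "y \<in> L" "z \<in> L" "y ! i \<noteq> z ! i"
        unfolding supp_def by blast
      then show "i \<in> supp (proj h (supp L) ` L)"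
        using i by (intro suppI[of i "proj h (supp L) y" _ "proj h (supp L) z"]) (auto simp: proj_nth)
    qed
  qed
  obtain i where i: "i \<in> supp L" using line_supp_nonempty[OF L] .
  then have id: "i < d" by (rule supp_less)
  show "line (proj h (supp L) ` L)"
  proof (rule line_image_coords[OF L Q _ id])
    show "\<not> (\<exists>c. \<forall>y\<in>L. proj h (supp L) y ! i = c)"
      using i id unfolding proj_nth[OF id] supp_def by (auto; metis)
  qed (auto simp: proj_nth)
  obtain z where z: "z \<in> L" "z ! i = h" using line_ex[OF L i h(1)] .
  have "proj h (supp L) z = replicate d h"
  proof (rule cube_eqI[OF Q[OF z(1)]])
    show "proj h (supp L) z ! j = replicate d h ! j" if "j < d" for j
      using line_coord[OF L i, of j z] z h that by (auto simp: proj_nth)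
  qed (use h in \<open>simp add: cube_iff\<close>)
  then show "replicate d h \<in> proj h (supp L) ` L" using z by (metis imageI)
qed

text \<open>The projection keeps the active set and the active coordinates. The inactive ones are
  those of the common point \<open>x\<close>, so the line can be recovered.\<close>

lemma inj_on_proj_pencil: "inj_on (\<lambda>L. proj h (supp L) ` L) (pencil x)"
  if h: "h < n" "opp h = h"
proof (rule inj_onI)
  fix L L' assume "L \<in> pencil x" "L' \<in> pencil x" and eq: "proj h (supp L) ` L = proj h (supp L') ` L'"
  then have L: "line L" "x \<in> L" and L': "line L'" "x \<in> L'" by (auto simp: pencil_def)
  have S: "supp L = supp L'" using proj_line(2)[OF L(1) h] proj_line(2)[OF L'(1) h] eq by simp
  have "A \<subseteq> B" if A: "line A" "x \<in> A" and B: "line B" "x \<in> B" and AB: "supp A = supp B"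
    and sub: "proj h (supp A) ` A = proj h (supp B) ` B" for A B
  proof
    fix y assume y: "y \<in> A"
    then obtain z where z: "z \<in> B" "proj h (supp A) y = proj h (supp B) z" using sub by blast
    have "y = z"
    proof (rule cube_eqI)
      fix j assume j: "j < d"
      show "y ! j = z ! j"
      proof (cases "j \<in> supp A")
        case True
        then show ?thesis using arg_cong[OF z(2), of "\<lambda>u. u ! j"] j AB by (simp add: proj_nth)
      next
        case False
        then show ?thesis using supp_const[OF j] A B AB y z by metis
      qed
    qed (use A B y z line_in_cube in blast)+
    then show "y \<in> B" using z by simp
  qed
  then show "L = L'" using L L' S eq by (intro equalityI) metis+
qed

text \<open>Projection injects the lines through \<open>x\<close> into those through the centre. It
  is not onto: with \<open>x ! i\<close> not central, at most one of the two centre lines with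
  active set \<open>{i, j}\<close> comes from a line through \<open>x\<close>.\<close>

lemma card_pencil_less_center:
  assumes h: "h < n" "opp h = h" and x: "x \<in> Q" "x \<noteq> replicate d h"
  shows "card (pencil x) < card (pencil (replicate d h))"
proof -
  let ?c = "replicate d h" and ?f = "\<lambda>L. proj h (supp L) ` L"
  have cQ: "?c \<in> Q" using h by (simp add: cube_iff)
  obtain i where i: "i < d" "x ! i \<noteq> h" using cube_neqE[OF x(1) cQ x(2)] by auto
  define j where "j = (if i = 0 then 1 else 0 :: nat)"
  have j: "j < d" "j \<noteq> i" using d2 by (auto simp: j_def)
  have sub: "?f ` pencil x \<subseteq> pencil ?c" using proj_line[OF _ h] by (auto simp: pencil_def)
  have "?f ` pencil x \<noteq> pencil ?c"
  proof
    assume onto: "?f ` pencil x = pencil ?c"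
    \<comment> \<open>The choice of \<open>e\<close> selects the centre line on which
      \<open>i\<close> and \<open>j\<close> run together (\<open>e = 0\<close>) or oppositely
      (\<open>e = opp 0\<close>). A preimage through \<open>x\<close> forces the same relation
      between \<open>x ! i\<close> and \<open>x ! j\<close>; both relations together make
      \<open>x ! i\<close> self-opposite.\<close>
    have x_rel: "x ! j = x ! i \<and> e = 0 \<or> x ! j = opp (x ! i) \<and> e = opp 0" if e: "e = 0 \<or> e = opp 0" for e
    proof -
      let ?y = "?c[i := 0, j := e]"
      have yQ: "?y \<in> Q" using cQ e n3 by (intro cube_update) auto
      obtain M where M: "line M" "?y \<in> M" "supp M = {i, j}" and
        pt: "map (\<lambda>a. if a \<in> {i, j} then if ?y ! a = 0 then h else opp h else ?y ! a) [0..<d] \<in> M"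
      proof (rule line_through[OF yQ, of "{i, j}" 0])
        show "?y ! a = 0 \<or> ?y ! a = opp 0" if "a \<in> {i, j}" for a
          using that e i j by auto
      qed (use i j n3 h in auto)
      have "map (\<lambda>a. if a \<in> {i, j} then if ?y ! a = 0 then h else opp h else ?y ! a) [0..<d] = ?c"
        using h by (intro nth_equalityI) auto
      then have "M \<in> pencil ?c" using M pt by (simp add: pencil_def)
      then obtain L where L: "L \<in> pencil x" "M = ?f L" using onto by blast
      then have "supp L = {i, j}" using proj_line(2)[OF _ h, of L] M(3) by (simp add: pencil_def)
      then have px: "proj h {i, j} x \<in> M" using L by (auto simp: pencil_def)
      have "(\<forall>z\<in>M. z ! j = z ! i) \<or> (\<forall>z\<in>M. z ! j = opp (z ! i))"
        using line_dir[OF M(1)] M(3) by blast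
      then have "proj h {i, j} x ! j = proj h {i, j} x ! i \<and> ?y ! j = ?y ! i \<or>
          proj h {i, j} x ! j = opp (proj h {i, j} x ! i) \<and> ?y ! j = opp (?y ! i)"
        using px M(2) by blast
      then show ?thesis using i(1) j by (simp add: proj_nth)
    qed
    have "opp 0 \<noteq> 0" using n3 by (simp add: opp_def)
    then have "x ! i = opp (x ! i)" using x_rel[of 0] x_rel[of "opp 0"] by auto
    then show False using i h(2) cube_nth[OF x(1) i(1)] h(1) unfolding opp_def by linarith
  qed
  with sub have "?f ` pencil x \<subset> pencil ?c" by blast
  then have "card (?f ` pencil x) < card (pencil ?c)" by (rule psubset_card_mono[OF finite_pencil])
  then show ?thesis using card_image[OF inj_on_proj_pencil[OF h]] by simp
qed

text \<open>A line permutation cannot lower the number of lines through a point, and only the centre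
  attains the maximum.\<close>

lemma LP_center:
  assumes "T \<in> LP" and h: "h < n" "opp h = h"
  shows "T (replicate d h) = replicate d h"
proof (rule ccontr)
  assume "T (replicate d h) \<noteq> replicate d h"
  moreover have "replicate d h \<in> Q" using h by (simp add: cube_iff)
  ultimately show False
    using card_pencil_less_center[OF h LP_in_cube] LP_card_pencil_le assms(1) leD by blast
qed

lemma center_line_coord:
  assumes h: "h < n" "opp h = h" and L: "L \<in> pencil (replicate d h)" and q: "q \<in> L" and i: "i < d"
    and qc: "q \<noteq> replicate d h"
  shows "q ! i = h \<longleftrightarrow> i \<notin> supp L"
proof -
  have l: "line L" "replicate d h \<in> L" using L by (auto simp: pencil_def)
  show ?thesis
  proof
    assume "q ! i = h"
    then show "i \<notin> supp L" using line_inj[OF l(1) _ q l(2), of i] qc i by auto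
  next
    assume "i \<notin> supp L"
    then show "q ! i = h" using supp_const[OF i _ q l(2)] i by simp
  qed
qed

text \<open>Only incidence and the centre enter, and the centre is fixed, so line permutations carry
  these lines along. One joining point would be too weak: a diagonal \<open>p\<close> other than the
  centre is also joined to points of centre lines that are not full.\<close>

definition doubly_joined :: "nat \<Rightarrow> nat list \<Rightarrow> nat list set set" where
  "doubly_joined h p = {L \<in> pencil (replicate d h).
     \<exists>q\<in>L. \<exists>q'\<in>L. q \<noteq> q' \<and> q \<noteq> replicate d h \<and> q' \<noteq> replicate d h \<and> col p q \<and> col p q'}"

lemma doubly_joined_supp:
  assumes h: "h < n" "opp h = h" and p: "p \<in> Q" "p \<noteq> replicate d h" and L: "L \<in> doubly_joined h p"
  shows "supp L = {i. i < d \<and> p ! i \<noteq> h}"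
proof -
  let ?c = "replicate d h"
  obtain q q' where LP: "L \<in> pencil ?c" and q: "q \<in> L" "q' \<in> L" "q \<noteq> q'" "q \<noteq> ?c" "q' \<noteq> ?c"
    and col: "col p q" "col p q'" using L by (auto simp: doubly_joined_def)
  have l: "line L" using LP by (simp add: pencil_def)
  have mid: "k = h" if "opp k = h" "k < n" for k using that h opp_eq_iff by metis
  note nh = center_line_coord[OF h LP]
  \<comment> \<open>From \<open>p\<close> to \<open>u\<close> a non-central entry becomes
    \<open>h\<close> at \<open>i\<close>, so \<open>l = h\<close> and every changed entry becomes
    \<open>h\<close>; at an active \<open>j\<close>, where \<open>u\<close> is not central,
    \<open>u\<close> must agree with \<open>p\<close>. For both \<open>q\<close> and
    \<open>q'\<close> this would give \<open>q = q'\<close>.\<close>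
  have key1: "u ! j = p ! j" if u: "u \<in> L" "u \<noteq> ?c" "col p u" and i: "i < d" "i \<notin> supp L" "p ! i \<noteq> h"
    and j: "j \<in> supp L" for u i j
  proof -
    obtain k l where kl: "k < n" "l < n"
      "\<And>i. i < d \<Longrightarrow> p ! i = u ! i \<or> p ! i = k \<and> u ! i = l \<or> p ! i = opp k \<and> u ! i = opp l"
      using col_coords[OF u(3) p(1) line_in_cube[OF l u(1)]] by blast
    have "u ! i = h" using nh[OF u(1) i(1) u(2)] i by simp
    then have "l = h" using kl(3)[OF i(1)] i(3) mid kl(2) by metis
    moreover have "u ! j \<noteq> h" using nh[OF u(1) supp_less[OF j] u(2)] j by simp
    ultimately show ?thesis using kl(3)[OF supp_less[OF j]] h by metis
  qed
  \<comment> \<open>A central entry of \<open>p\<close> changes at \<open>i\<close>, so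
    \<open>k = h\<close> and only central entries of \<open>p\<close> change. As \<open>q\<close>
    and \<open>q'\<close> differ at every active coordinate, \<open>p\<close> is central there, and
    by \<open>sub\<close> also elsewhere, hence equal to the centre.\<close>
  have key2: "p ! j = u ! j \<or> p ! j = h" if u: "u \<in> L" "u \<noteq> ?c" "col p u" and i: "i \<in> supp L" "p ! i = h"
    and j: "j < d" for u i j
  proof -
    obtain k l where kl: "k < n" "l < n"
      "\<And>i. i < d \<Longrightarrow> p ! i = u ! i \<or> p ! i = k \<and> u ! i = l \<or> p ! i = opp k \<and> u ! i = opp l"
      using col_coords[OF u(3) p(1) line_in_cube[OF l u(1)]] by blast
    have "u ! i \<noteq> h" using nh[OF u(1) supp_less[OF i(1)] u(2)] i by simp
    then have "k = h" using kl(3)[OF supp_less[OF i(1)]] i(2) mid kl(1) by metis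
    then show ?thesis using kl(3)[OF j] h by metis
  qed
  obtain a where a: "a \<in> supp L" using line_supp_nonempty[OF l] .
  have sub: "i \<in> supp L" if i: "i < d" "p ! i \<noteq> h" for i
  proof (rule ccontr)
    assume "i \<notin> supp L"
    then have "q ! a = q' ! a" using key1[OF _ _ _ i(1) _ i(2) a] q col by metis
    then show False using line_inj[OF l a] q by blast
  qed
  have "p ! i \<noteq> h" if i: "i \<in> supp L" for i
  proof
    assume ph: "p ! i = h"
    have "p ! j = h" if j: "j < d" for j
    proof (cases "j \<in> supp L")
      case True
      then have "q ! j \<noteq> q' ! j" using line_inj[OF l True] q by blast
      then show ?thesis using key2[OF _ _ _ i ph j] q col by metis
    qed (use sub j in blast)
    then have "p = ?c" using p h by (intro cube_eqI) (auto simp: cube_iff)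
    then show False using p by simp
  qed
  then show ?thesis using sub supp_less by blast
qed

lemma LP_card_doubly_joined_le:
  assumes T: "T \<in> LP" and h: "h < n" "opp h = h"
  shows "card (doubly_joined h p) \<le> card (doubly_joined h (T p))"
proof (rule card_inj_on_le)
  let ?c = "replicate d h"
  have cQ: "?c \<in> Q" using h by (simp add: cube_iff)
  note Tc = LP_center[OF T h]
  show "inj_on ((`) T) (doubly_joined h p)"
    by (rule inj_on_subset[OF LP_inj_on_lines[OF T]]) (auto simp: doubly_joined_def pencil_def)
  show "(`) T ` doubly_joined h p \<subseteq> doubly_joined h (T p)"
  proof (rule image_subsetI)
    fix L assume "L \<in> doubly_joined h p"
    then obtain q q' where L: "line L" "?c \<in> L" and q: "q \<in> L" "q' \<in> L" "q \<noteq> q'" "q \<noteq> ?c" "q' \<noteq> ?c"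
      and col: "col p q" "col p q'" by (auto simp: doubly_joined_def pencil_def)
    have "q \<in> Q" "q' \<in> Q" using q L line_in_cube by auto
    then have "T q \<noteq> T q'" "T q \<noteq> ?c" "T q' \<noteq> ?c" using LP_eq_iff[OF T] q cQ Tc by metis+
    moreover have "T ` L \<in> pencil ?c" using LP_line[OF T L(1)] L(2) Tc by (auto simp: pencil_def image_iff) metis
    ultimately show "T ` L \<in> doubly_joined h (T p)"
      unfolding doubly_joined_def using q col LP_col[OF T] by blast
  qed
  show "finite (doubly_joined h (T p))"
    by (rule finite_subset[OF _ finite_pencil]) (auto simp: doubly_joined_def)
qed

text \<open>The two points of \<open>L\<close> whose first coordinate is \<open>k\<close> or
  \<open>opp k\<close>, with \<open>k\<close> the first coordinate of \<open>p\<close>, have all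
  coordinates in \<open>{k, opp k}\<close>, as has \<open>p\<close>. Reversing the coordinates that
  disagree joins each to \<open>p\<close>.\<close>

lemma full_center_line_doubly_joined:
  assumes h: "h < n" "opp h = h" and p: "diag p" "p \<noteq> replicate d h"
    and L: "L \<in> pencil (replicate d h)" "supp L = {..<d}"
  shows "L \<in> doubly_joined h p"
proof -
  let ?c = "replicate d h"
  have l: "line L" "?c \<in> L" using L by (auto simp: pencil_def)
  have pQ: "p \<in> Q" using p by (simp add: diag_def)
  define k where "k = p ! 0"
  have d0: "0 < d" using d2 by simp
  have k: "k < n" using cube_nth[OF pQ d0] by (simp add: k_def)
  have pk: "p ! i = k \<or> p ! i = opp k" if "i < d" for i using p(1) that d0 by (simp add: diag_def k_def)
  have kh: "k \<noteq> h"
  proof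
    assume "k = h"
    then have "p = ?c" using pk pQ h by (intro cube_eqI) (auto simp: cube_iff)
    then show False using p by simp
  qed
  then have ok: "opp k \<noteq> k" "opp k \<noteq> h" using k h unfolding opp_def by linarith+
  obtain q where q: "q \<in> L" "q ! 0 = k" using line_ex[OF l(1), of 0 k] L(2) d0 k by auto
  obtain q' where q': "q' \<in> L" "q' ! 0 = opp k" using line_ex[OF l(1), of 0 "opp k"] L(2) d0 by auto
  have c: "col p u" if u: "u \<in> L" "u ! 0 = k \<or> u ! 0 = opp k" for u
  proof (rule colI[OF pQ line_in_cube[OF l(1) u(1)] k, of "opp k"])
    show "p ! i = u ! i \<or> p ! i = k \<and> u ! i = opp k \<or> p ! i = opp k \<and> u ! i = opp (opp k)" if "i < d" for i
    proof -
      have "u ! i = u ! 0 \<or> u ! i = opp (u ! 0)" using line_coord[OF l(1), of 0 i u] L(2) d0 that u(1) by simp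
      then show ?thesis using u(2) pk[OF that] opp_opp[OF k] by metis
    qed
  qed simp
  have "q \<noteq> q'" "q \<noteq> ?c" "q' \<noteq> ?c" using q q' kh ok d0 by auto
  then show ?thesis unfolding doubly_joined_def using L(1) q q' c by blast
qed

text \<open>Letting all missing coordinates copy one coordinate \<open>i\<close> of \<open>S\<close>
  extends a centre line to a full one injectively. A full centre line on which some missing
  \<open>j\<close> runs against \<open>i\<close> is not obtained.\<close>

lemma card_center_lines_less:
  assumes h: "h < n" "opp h = h" and S: "S \<subset> {..<d}"
  shows "card {L \<in> pencil (replicate d h). supp L = S} < card {L \<in> pencil (replicate d h). supp L = {..<d}}"
    (is "card ?A < card ?B")
proof -
  let ?c = "replicate d h"
  have cQ: "?c \<in> Q" using h by (simp add: cube_iff)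
  have fin: "finite ?A" "finite ?B" by (auto intro: finite_subset[OF _ finite_pencil])
  \<comment> \<open>For empty \<open>S\<close> this choice is arbitrary, but then \<open>?A\<close>
    is empty; every member of \<open>?A\<close> guarantees \<open>i \<in> S\<close>.\<close>
  define i where "i = (SOME i. i \<in> S)"
  define f where "f y = map (\<lambda>a. if a \<in> S then y ! a else y ! i) [0..<d]" for y :: "nat list"
  have f_nth: "f y ! a = (if a \<in> S then y ! a else y ! i)" if "a < d" for a y using that by (simp add: f_def)
  obtain j where j: "j < d" "j \<notin> S" using S by blast
  have A: "line L" "?c \<in> L" "supp L = S" "i \<in> S" "i < d" if "L \<in> ?A" for L
  proof -
    show *: "line L" "?c \<in> L" "supp L = S" using that by (auto simp: pencil_def)
    show "i \<in> S" unfolding i_def using supp_nonempty[OF *(1)] *(3) by (metis some_in_eq)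
    then show "i < d" using S by blast
  qed
  have sub: "(`) f ` ?A \<subseteq> ?B"
  proof (rule image_subsetI)
    fix L assume L: "L \<in> ?A"
    note a = A[OF L]
    have lin: "line (f ` L)"
    proof (rule line_image_coords[OF a(1) _ _ a(5)])
      show "f y \<in> Q" if "y \<in> L" for y
        unfolding f_def using cube_nth[OF line_in_cube[OF a(1) that]] a(5) by (intro tab_cube) auto
      show "\<not> (\<exists>c. \<forall>y\<in>L. f y ! i = c)"
        using a(3,4) unfolding f_nth[OF a(5)] supp_def by (auto; metis)
      show "(\<exists>c. \<forall>y\<in>L. f y ! b = c) \<or>
        (\<exists>j\<in>supp L. (\<forall>y\<in>L. f y ! b = y ! j) \<or> (\<forall>y\<in>L. f y ! b = opp (y ! j)))" if "b < d" for b
        using a(3,4) that by (cases "b \<in> S") (auto simp: f_nth)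
    qed
    have "f ?c = ?c" using a(5) by (intro nth_equalityI) (auto simp: f_def)
    then have "?c \<in> f ` L" using a(2) by (metis imageI)
    moreover have "supp (f ` L) = {..<d}"
    proof
      show "{..<d} \<subseteq> supp (f ` L)"
      proof
        fix b assume b: "b \<in> {..<d}"
        define b' where "b' = (if b \<in> S then b else i)"
        have "b' \<in> supp L" using a by (simp add: b'_def)
        then obtain y z where "y \<in> L" "z \<in> L" "y ! b' \<noteq> z ! b'" unfolding supp_def by blast
        then show "b \<in> supp (f ` L)" using b
          by (intro suppI[of b "f y" _ "f z"]) (auto simp: f_nth b'_def)
      qed
    qed (use supp_less in blast)
    ultimately show "f ` L \<in> ?B" using lin by (simp add: pencil_def)
  qed
  have inj: "inj_on ((`) f) ?A"
  proof (rule inj_on_inverseI)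
    fix L assume L: "L \<in> ?A"
    have "proj h S (f y) = y" if y: "y \<in> L" for y
    proof (rule nth_equalityI)
      show "length (proj h S (f y)) = length y" using line_in_cube[OF A(1)[OF L] y] by (simp add: proj_def cube_iff)
      fix a assume "a < length (proj h S (f y))"
      then have a: "a < d" by (simp add: proj_def)
      show "proj h S (f y) ! a = y ! a"
        using supp_const[OF a _ y A(2)[OF L]] A(3)[OF L] a by (auto simp: proj_nth f_nth)
    qed
    then show "(`) (proj h S) (f ` L) = L" by (simp add: image_image)
  qed
  \<comment> \<open>Coordinate \<open>j\<close> is opposed to all others here, so the full centre
    line through \<open>?y\<close> cannot be an extension in which \<open>j\<close> copies
    \<open>i\<close>.\<close>
  let ?y = "(replicate d 0)[j := opp 0]"
  have yQ: "?y \<in> Q" using n3 by (intro cube_update) (auto simp: cube_iff)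
  obtain M where M: "line M" "?y \<in> M" "supp M = {..<d}" and
    pt: "map (\<lambda>a. if a \<in> {..<d} then if ?y ! a = 0 then h else opp h else ?y ! a) [0..<d] \<in> M"
  proof (rule line_through[OF yQ, of "{..<d}" 0])
    show "?y ! a = 0 \<or> ?y ! a = opp 0" if "a \<in> {..<d}" for a
      using that j by (cases "a = j") auto
  qed (use d2 n3 h in \<open>auto simp: lessThan_empty_iff\<close>)
  have "map (\<lambda>a. if a \<in> {..<d} then if ?y ! a = 0 then h else opp h else ?y ! a) [0..<d] = ?c"
    using h by (intro nth_equalityI) auto
  then have MB: "M \<in> ?B" using M pt by (simp add: pencil_def)
  have "M \<notin> (`) f ` ?A"
  proof
    assume "M \<in> (`) f ` ?A"
    then obtain L where L: "L \<in> ?A" "M = f ` L" by blast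
    then obtain u where u: "?y = f u" using M by blast
    have i: "i \<in> S" "i < d" using A[OF L(1)] by auto
    then have "?y ! j = ?y ! i" using j by (simp only: u f_nth) simp
    then show False using i j n3 by (cases "i = j") (auto simp: opp_def)
  qed
  then have "(`) f ` ?A \<subset> ?B" using sub MB by blast
  then have "card ((`) f ` ?A) < card ?B" using fin by (intro psubset_card_mono)
  then show ?thesis using card_image[OF inj] by simp
qed

text \<open>All full centre lines are doubly joined to \<open>p\<close>, so at least as many lines
  are doubly joined to \<open>T p\<close>. These vary exactly in the non-central coordinates of
  \<open>T p\<close>; if such coordinates formed a proper subset, there would be too few
  lines.\<close>

lemma LP_no_middle_coord:
  assumes T: "T \<in> LP" and h: "h < n" "opp h = h" and p: "diag p" "p \<noteq> replicate d h" and i: "i < d"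
  shows "T p ! i \<noteq> h"
proof
  let ?c = "replicate d h" and ?S = "{i. i < d \<and> T p ! i \<noteq> h}"
  assume "T p ! i = h"
  then have S: "?S \<subset> {..<d}" using i by blast
  have pQ: "p \<in> Q" and cQ: "?c \<in> Q" using p h by (auto simp: diag_def cube_iff)
  have Tp: "T p \<noteq> ?c" using LP_center[OF T h] LP_eq_iff[OF T pQ cQ] p(2) by metis
  have "card {L \<in> pencil ?c. supp L = {..<d}} \<le> card (doubly_joined h p)"
    using full_center_line_doubly_joined[OF h p]
    by (intro card_mono finite_subset[OF _ finite_pencil[of ?c]]) (auto simp: doubly_joined_def)
  also have "\<dots> \<le> card (doubly_joined h (T p))" by (rule LP_card_doubly_joined_le[OF T h])
  also have "\<dots> \<le> card {L \<in> pencil ?c. supp L = ?S}"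
    using doubly_joined_supp[OF h LP_in_cube[OF T pQ] Tp]
    by (intro card_mono finite_subset[OF _ finite_pencil[of ?c]]) (auto simp: doubly_joined_def)
  also have "\<dots> < card {L \<in> pencil ?c. supp L = {..<d}}" by (rule card_center_lines_less[OF h S])
  finally show False by simp
qed

text \<open>A non-central diagonal point lies on a full line through the centre. The image line
  contains the centre and \<open>T x\<close>, which differ in every coordinate, so it is full
  again.\<close>

lemma LP_diag_odd:
  assumes T: "T \<in> LP" and h: "h < n" "opp h = h" and x: "diag x"
  shows "diag (T x)"
proof (cases "x = replicate d h")
  case True
  then show ?thesis using LP_center[OF T h] x by simp
next
  case False
  let ?c = "replicate d h"
  have xQ: "x \<in> Q" and cQ: "?c \<in> Q" using x h by (auto simp: diag_def cube_iff)
  have d0: "0 < d" using d2 by simp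
  have *: "x ! i = x ! 0 \<or> x ! i = opp (x ! 0)" if "i < d" for i using x d0 that by (simp add: diag_def)
  obtain L where L: "line L" "x \<in> L" "supp L = {..<d}" and
    pt: "map (\<lambda>a. if a \<in> {..<d} then if x ! a = x ! 0 then h else opp h else x ! a) [0..<d] \<in> L"
  proof (rule line_through[OF xQ, of "{..<d}" "x ! 0"])
    show "x ! i = x ! 0 \<or> x ! i = opp (x ! 0)" if "i \<in> {..<d}" for i using * that by simp
  qed (use d0 h(1) cube_nth[OF xQ d0] in \<open>auto simp: lessThan_empty_iff\<close>)
  have "map (\<lambda>a. if a \<in> {..<d} then if x ! a = x ! 0 then h else opp h else x ! a) [0..<d] = ?c"
    using h by (intro nth_equalityI) auto
  then have cL: "?c \<in> L" using pt by simp
  have "supp (T ` L) = {..<d}"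
  proof
    show "{..<d} \<subseteq> supp (T ` L)"
    proof
      fix i assume "i \<in> {..<d}"
      then have i: "i < d" by simp
      have "T x ! i \<noteq> T ?c ! i" using LP_no_middle_coord[OF T h x False i] LP_center[OF T h] i by simp
      then show "i \<in> supp (T ` L)" by (rule suppI[OF i imageI[OF L(2)] imageI[OF cL]])
    qed
  qed (use supp_less in blast)
  then show ?thesis by (rule full_line_diag[OF LP_line[OF T L(1)] _ imageI[OF L(2)]])
qed

lemma LP_diag:
  assumes T: "T \<in> LP" and x: "diag x"
  shows "diag (T x)"
  using LP_diag_even[OF T _ x] LP_diag_odd[OF T _ _ x] by blast

lemma LP_diag_iff:
  assumes T: "T \<in> LP" and x: "x \<in> Q"
  shows "diag (T x) \<longleftrightarrow> diag x"
proof -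
  obtain S where S: "S \<in> LP" "\<And>x. x \<in> Q \<Longrightarrow> S (T x) = x" using LP_inverse[OF T] by blast
  then show ?thesis using LP_diag[OF T] LP_diag[OF S(1), of "T x"] x by auto
qed

text \<open>Being full is visible in the points, by \<open>diag_line_full\<close>, and diagonal
  points are preserved in both directions. Later uses are contrapositive: lines that are not full
  stay not full.\<close>

lemma LP_full_line:
  assumes T: "T \<in> LP" and L: "line L" "supp (T ` L) = {..<d}"
  shows "supp L = {..<d}"
proof (rule diag_line_full[OF L(1)])
  fix x assume x: "x \<in> L"
  then have "diag (T x)" using full_line_diag[OF LP_line[OF T L(1)] L(2)] by blast
  then show "diag x" using LP_diag_iff[OF T line_in_cube[OF L(1) x]] by simp
qed

section \<open>Corners and the lines joining them\<close>

abbreviation C where "C \<equiv> corners n d"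

lemma corners_iff: "x \<in> C \<longleftrightarrow> x \<in> Q \<and> (\<forall>i<d. x ! i = 0 \<or> x ! i = opp 0)"
  by (auto simp: corners_def cube_def opp_def set_conv_nth)

lemma corner_in_cube: "x \<in> C \<Longrightarrow> x \<in> Q" by (simp add: corners_def)

lemma opp_0_neq: "opp 0 \<noteq> 0" "0 \<noteq> opp 0" using n3 by (auto simp: opp_def)

lemma opp_opp_0 [simp]: "opp (opp 0) = 0" using n3 by simp

lemma corner_diag: "x \<in> C \<Longrightarrow> diag x"
  by (auto simp: corners_iff diag_def) (metis opp_opp_0)+

lemma line_supp_eq:
  assumes L: "line L" "x \<in> L" "y \<in> L" "x \<noteq> y"
  shows "supp L = {i. i < d \<and> x ! i \<noteq> y ! i}"
proof (intro equalityI subsetI)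
  fix i assume i: "i \<in> supp L"
  then have "x ! i \<noteq> y ! i" using line_inj[OF L(1) i L(2,3)] L(4) by blast
  then show "i \<in> {i. i < d \<and> x ! i \<noteq> y ! i}" using supp_less[OF i] by simp
next
  fix i assume "i \<in> {i. i < d \<and> x ! i \<noteq> y ! i}"
  then show "i \<in> supp L" using suppI L by blast
qed

lemma corner_line:
  assumes "x \<in> C" "y \<in> C" "x \<noteq> y"
  obtains L where "line L" "x \<in> L" "y \<in> L" "supp L = {i. i < d \<and> x ! i \<noteq> y ! i}"
proof -
  have Q: "x \<in> Q" "y \<in> Q" using assms corner_in_cube by auto
  have c: "x ! i = 0 \<or> x ! i = opp 0" "y ! i = 0 \<or> y ! i = opp 0" if "i < d" for i
    using assms that by (auto simp: corners_iff)
  have "col x y"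
  proof (rule colI[OF Q, of 0 "opp 0"])
    show "x ! i = y ! i \<or> x ! i = 0 \<and> y ! i = opp 0 \<or> x ! i = opp 0 \<and> y ! i = opp (opp 0)" if "i < d" for i
      using c[OF that] by auto
  qed (use n3 in auto)
  then obtain L where L: "line L" "x \<in> L" "y \<in> L" using assms(3) by (auto simp: col_def)
  then show ?thesis using that line_supp_eq[OF L assms(3)] by blast
qed

subsection \<open>Corners are sent to one level\<close>

lemma LP_corner_level:
  assumes T: "T \<in> LP" and x: "x \<in> C" and y: "y \<in> C"
  shows "T y ! 0 = T x ! 0 \<or> T y ! 0 = opp (T x ! 0)"
proof -
  have d0: "0 < d" "1 < d" using d2 by auto
  have near: "T y ! 0 = T x ! 0 \<or> T y ! 0 = opp (T x ! 0)" if x: "x \<in> C" and y: "y \<in> C"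
    and i: "i < d" "x ! i = y ! i" for x y i
  proof (cases "x = y")
    case False
    obtain L where L: "line L" "x \<in> L" "y \<in> L" "supp L = {i. i < d \<and> x ! i \<noteq> y ! i}"
      using corner_line[OF x y False] .
    then have "supp (T ` L) \<noteq> {..<d}" using LP_full_line[OF T L(1)] i by blast
    then obtain j where j: "j < d" "j \<notin> supp (T ` L)" using supp_less by blast
    have "T x ! j = T y ! j" by (rule supp_const[OF j imageI[OF L(2)] imageI[OF L(3)]])
    moreover have "diag (T x)" "diag (T y)" using LP_diag[OF T corner_diag] x y by auto
    ultimately show ?thesis using j(1) d0 unfolding diag_def by (metis cube_nth opp_opp)
  qed simp
  \<comment> \<open>The corner \<open>z\<close> shares coordinate 0 with \<open>y\<close> and
    coordinate 1 with \<open>x\<close>, so two applications of \<open>near\<close> link arbitrary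
    corners.\<close>
  define z where "z = x[0 := y ! 0]"
  have "z ! i = (if i = 0 then y ! 0 else x ! i)" if "i < d" for i
    using that x by (simp add: z_def corners_iff cube_iff)
  moreover have zQ: "z \<in> Q" unfolding z_def
    using x y d0 by (intro cube_update) (auto simp: corners_iff cube_iff)
  ultimately have z: "z \<in> C" "z ! 0 = y ! 0" "z ! 1 = x ! 1" using x y d0 by (auto simp: corners_iff)
  have "T x ! 0 < n" "T z ! 0 < n" using x z cube_nth[OF LP_in_cube[OF T corner_in_cube]] d0 by auto
  then show ?thesis using near[OF z(1) y d0(1) z(2)] near[OF x z(1) d0(2) z(3)[symmetric]] by (metis opp_opp)
qed

section \<open>Coordinate maps as line permutations\<close>

lemma coord_map_nth: "x \<in> Q \<Longrightarrow> i < d \<Longrightarrow> coord_map n d \<pi> x ! i = \<pi> (x ! i)"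
  by (simp add: coord_map_def cube_iff)

text \<open>Reparametrizing the line by the inverse of \<open>\<pi>\<close> restores monotonicity:
  an upward coordinate becomes \<open>k\<close> again, a downward one \<open>opp k\<close> because
  \<open>\<pi>\<close> commutes with \<open>opp\<close>.\<close>

lemma coord_map_LP:
  assumes p: "\<pi> permutes {..<n}" and sym: "\<And>k. k < n \<Longrightarrow> \<pi> (opp k) = opp (\<pi> k)"
  shows "coord_map n d \<pi> \<in> coord_group n d" "coord_map n d \<pi> \<in> LP"
proof -
  have "n - k - 1 = opp k" for k by (simp add: opp_def)
  then show G: "coord_map n d \<pi> \<in> coord_group n d" unfolding coord_group_def using p sym by auto
  then have B: "coord_map n d \<pi> \<in> Bij Q" using coord_group_Bij by blast
  have "line (coord_map n d \<pi> ` L)" if L: "line L" for L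
  proof -
    obtain i where i: "i \<in> supp L" using line_supp_nonempty[OF L] .
    obtain q where q: "L = q ` {..<n}" "\<And>j. j \<in> supp L \<Longrightarrow> (\<forall>k<n. q k ! j = k) \<or> (\<forall>k<n. q k ! j = opp k)"
      using line_param_supp[OF L i] by blast
    let ?r = "inv_into UNIV \<pi>"
    have r: "?r permutes {..<n}" by (rule permutes_inv[OF p])
    have rn: "?r k < n" if "k < n" for k using permutes_in_image[OF r, of k] that by simp
    have pr: "\<pi> (?r k) = k" for k by (rule permutes_inverses(1)[OF p])
    have qQ: "q k \<in> Q" if "k < n" for k using that L line_in_cube q(1) by blast
    let ?f = "\<lambda>k. coord_map n d \<pi> (q (?r k))"
    have nth: "?f k ! j = \<pi> (q (?r k) ! j)" if "k < n" "j < d" for j k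
      using coord_map_nth[OF qQ[OF rn]] that by blast
    have im: "coord_map n d \<pi> ` L = ?f ` {..<n}"
      unfolding q(1) using permutes_image[OF r] by (metis image_image)
    have val: "(\<forall>k<n. ?f k ! j = k) \<or> (\<forall>k<n. ?f k ! j = opp k)" if j: "j \<in> supp L" for j
      using q(2)[OF j] by (auto simp: nth supp_less[OF j] rn pr sym)
    have "line (?f ` {..<n})"
    proof (rule lineI[OF _ _ supp_less[OF i]])
      show "?f k \<in> Q" if "k < n" for k using B qQ[OF rn[OF that]] by (auto simp: Bij_def bij_betw_def)
      show "(\<forall>k<n. ?f k ! j = k) \<or> (\<forall>k<n. ?f k ! j = opp k) \<or> (\<exists>c. \<forall>k<n. ?f k ! j = c)" if "j < d" for j
      proof (cases "j \<in> supp L")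
        case False
        have "q (?r k) ! j = q 0 ! j" if "k < n" for k
          using supp_const[OF \<open>j < d\<close> False, of "q (?r k)" "q 0"] rn[OF that] q(1) n3 by auto
        then show ?thesis using nth \<open>j < d\<close> by auto
      qed (use val in blast)
      show "\<not> (\<exists>c. \<forall>k<n. ?f k ! i = c)"
      proof
        assume "\<exists>c. \<forall>k<n. ?f k ! i = c"
        then have "?f 0 ! i = ?f 1 ! i" using n3 by auto
        then show False using val[OF i] n3 opp_inj[of 0 1] by auto
      qed
    qed
    then show ?thesis by (simp add: im)
  qed
  then show "coord_map n d \<pi> \<in> LP" using B by (simp add: line_perms_def)
qed

lemma compose_LP:
  assumes "A \<in> LP" "T \<in> LP"
  shows "compose Q A T \<in> LP"
proof -
  have "compose Q A T \<in> Bij Q" using assms compose_Bij by (auto simp: line_perms_def)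
  moreover have "line (compose Q A T ` L)" if "line L" for L
  proof -
    have "compose Q A T ` L = A ` (T ` L)" using line_in_cube[OF that] by (auto simp: compose_def image_image)
    then show ?thesis using assms LP_line that by simp
  qed
  ultimately show ?thesis by (simp add: line_perms_def)
qed

lemma compose_nth: "x \<in> Q \<Longrightarrow> compose Q A T x = A (T x)" by (simp add: compose_def)

section \<open>Elements of the generated group; moving images of corners back to corners\<close>

abbreviation G where "G \<equiv> aut_group n d"

lemma G_compose: "A \<in> G \<Longrightarrow> B \<in> G \<Longrightarrow> compose Q A B \<in> G"
  using subgroup.m_closed[OF subgroup_aut_group[OF d2], of A n B]
    subgroup.mem_carrier[OF subgroup_aut_group[OF d2]]
  by (auto simp: BijGroup_def)

lemma G_Bij: "A \<in> G \<Longrightarrow> A \<in> Bij Q"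
  using subgroup.mem_carrier[OF subgroup_aut_group[OF d2]] by (auto simp: BijGroup_def)

lemma G_coord: "coord_group n d \<subseteq> G"
  unfolding aut_group_def by (auto intro: generate.incl)

lemma G_swap: "swap_last n d \<in> G"
  unfolding aut_group_def swap_group_def by (auto intro: generate.incl)

lemma G_id: "(\<lambda>x\<in>Q. x) \<in> G"
  using subgroup.one_closed[OF subgroup_aut_group[OF d2], of n] by (simp add: BijGroup_def)

lemma G_rot:
  assumes "i < d" "j < d" "i \<noteq> j"
  shows "rot n d i j \<in> G"
proof -
  have "rot n d i j \<in> rot_group n d" unfolding rot_group_def using assms by (intro generate.incl) auto
  then show ?thesis unfolding aut_group_def by (auto intro: generate.incl)
qed

lemma LP_move_corners:
  assumes T: "T \<in> LP"
  obtains A where "A \<in> G" "A \<in> LP" "\<And>x. x \<in> C \<Longrightarrow> A (T x) \<in> C"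
proof -
  have d0: "0 < d" using d2 by simp
  define o' where "o' = replicate d (0::nat)"
  have oC: "o' \<in> C" using n3 by (auto simp: o'_def corners_iff cube_iff)
  define w where "w = T o' ! 0"
  have w: "w < n" using cube_nth[OF LP_in_cube[OF T corner_in_cube[OF oC]] d0] by (simp add: w_def)
  have lev: "T x ! i = w \<or> T x ! i = opp w" if x: "x \<in> C" and i: "i < d" for x i
  proof -
    have "T x ! 0 = w \<or> T x ! 0 = opp w" using LP_corner_level[OF T oC x] by (simp add: w_def)
    moreover have "T x ! i = T x ! 0 \<or> T x ! i = opp (T x ! 0)"
      using LP_diag[OF T corner_diag[OF x]] i d0 by (simp add: diag_def)
    ultimately show ?thesis using w by (metis opp_opp)
  qed
  \<comment> \<open>If \<open>w\<close> were self-opposite, all corners would be sent to the single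
    point with constant coordinate \<open>w\<close>, against injectivity.\<close>
  have wo: "opp w \<noteq> w"
  proof
    assume "opp w = w"
    then have eq: "T x = T o'" if "x \<in> C" for x
      using that lev oC LP_in_cube[OF T corner_in_cube] by (intro cube_eqI) auto
    have e: "o'[0 := opp 0] \<in> C"
      using n3 by (auto simp: o'_def corners_iff cube_iff nth_list_update)
    have "o'[0 := opp 0] = o'" using eq[OF e] LP_eq_iff[OF T] e oC corner_in_cube by blast
    then have "o'[0 := opp 0] ! 0 = o' ! 0" by simp
    then show False using d0 opp_0_neq by (simp add: o'_def)
  qed
  \<comment> \<open>Outside the trivial case \<open>0\<close>, \<open>opp 0\<close>,
    \<open>w\<close>, \<open>opp w\<close> are four distinct values; the two transpositions exchange
    the pairs and commute with \<open>opp\<close>.\<close>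
  define \<pi> where "\<pi> = (if w = 0 \<or> w = opp 0 then id else transpose 0 w \<circ> transpose (opp 0) (opp w))"
  have oo: "opp w \<noteq> 0" "opp w \<noteq> opp 0" if "w \<noteq> 0" "w \<noteq> opp 0"
    using that w n3 unfolding opp_def by linarith+
  have perm: "\<pi> permutes {..<n}"
    unfolding \<pi>_def using w n3
    by (auto intro!: permutes_compose permutes_swap_id permutes_id)
  have sym: "\<pi> (opp k) = opp (\<pi> k)" if k: "k < n" for k
  proof (cases "w = 0 \<or> w = opp 0")
    case False
    then have "\<pi> m = (if m = 0 then w else if m = w then 0 else if m = opp 0 then opp w
        else if m = opp w then opp 0 else m)" for m
      using oo wo opp_0_neq unfolding \<pi>_def by (auto simp: transpose_def)
    moreover have "opp k = 0 \<longleftrightarrow> k = opp 0" "opp k = opp 0 \<longleftrightarrow> k = 0" "opp k = w \<longleftrightarrow> k = opp w" "opp k = opp w \<longleftrightarrow> k = w"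
      using k w n3 opp_eq_iff opp_inj by auto
    ultimately show ?thesis using oo wo opp_0_neq False w by auto
  qed (simp add: \<pi>_def)
  have pw: "\<pi> w = 0 \<or> \<pi> w = opp 0"
    using oo wo opp_0_neq unfolding \<pi>_def by (auto simp: transpose_def)
  then have pw': "\<pi> (opp w) = 0 \<or> \<pi> (opp w) = opp 0" using sym[OF w] by auto
  have A: "coord_map n d \<pi> (T x) \<in> C" if x: "x \<in> C" for x
  proof -
    have TQ: "T x \<in> Q" by (rule LP_in_cube[OF T corner_in_cube[OF x]])
    have "coord_map n d \<pi> (T x) ! i = 0 \<or> coord_map n d \<pi> (T x) ! i = opp 0" if "i < d" for i
      using lev[OF x that] pw pw' coord_map_nth[OF TQ that] by metis
    then show ?thesis using LP_in_cube[OF coord_map_LP(2)[OF perm sym] TQ] by (simp add: corners_iff)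
  qed
  show ?thesis using that[OF _ coord_map_LP(2)[OF perm sym] A] coord_map_LP(1)[OF perm sym] G_coord by blast
qed

subsection \<open>Adjacency of corners\<close>

text \<open>An injective self-map of the finite set of corners is onto, which leaves no corner as
  the image of another point.\<close>

lemma LP_corner_iff:
  assumes T: "T \<in> LP" and C: "\<And>x. x \<in> C \<Longrightarrow> T x \<in> C" and x: "x \<in> Q"
  shows "T x \<in> C \<longleftrightarrow> x \<in> C"
proof
  have "finite C" by (rule finite_subset[OF _ finite_cube]) (auto simp: corners_def)
  moreover have "inj_on T C" by (rule inj_on_subset[OF LP_inj_on[OF T]]) (auto simp: corners_def)
  ultimately have surj: "T ` C = C" using C by (intro endo_inj_surj) auto
  assume "T x \<in> C"
  then obtain c where c: "c \<in> C" "T x = T c" using surj by (metis imageE)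
  then show "x \<in> C" using LP_eq_iff[OF T x corner_in_cube[OF c(1)]] by simp
qed (rule C)

definition adj :: "nat list \<Rightarrow> nat list \<Rightarrow> bool" where
  "adj x y \<longleftrightarrow> (\<exists>i<d. x ! i \<noteq> y ! i \<and> (\<forall>j<d. j \<noteq> i \<longrightarrow> x ! j = y ! j))"

text \<open>An incidence condition meant to hold exactly for distinct non-adjacent corners. For
  \<open>n = 3\<close> the inner point \<open>p\<close> can lie on the second line itself; for
  larger \<open>n\<close> it is joined to two inner points of that line.\<close>

definition crossed :: "nat list \<Rightarrow> nat list \<Rightarrow> bool" where
  "crossed x y \<longleftrightarrow> (\<exists>L L' a b p. line L \<and> x \<in> L \<and> y \<in> L \<and> line L' \<and> L' \<noteq> L \<and>
     a \<in> C \<and> b \<in> C \<and> a \<in> L' \<and> b \<in> L' \<and> a \<noteq> b \<and> p \<in> L \<and> p \<notin> C \<and>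
     (p \<in> L' \<or> (\<exists>p'\<in>L'. \<exists>p''\<in>L'. p' \<noteq> p'' \<and> p' \<notin> C \<and> p'' \<notin> C \<and> col p p' \<and> col p p'')))"

lemma LP_crossed:
  assumes T: "T \<in> LP" and TC: "\<And>x. x \<in> Q \<Longrightarrow> T x \<in> C \<longleftrightarrow> x \<in> C" and xy: "crossed x y"
  shows "crossed (T x) (T y)"
proof -
  obtain L L' a b p where L: "line L" "x \<in> L" "y \<in> L" and L': "line L'" "L' \<noteq> L"
    "a \<in> C" "b \<in> C" "a \<in> L'" "b \<in> L'" "a \<noteq> b" and p: "p \<in> L" "p \<notin> C"
    and alt: "p \<in> L' \<or> (\<exists>p'\<in>L'. \<exists>p''\<in>L'. p' \<noteq> p'' \<and> p' \<notin> C \<and> p'' \<notin> C \<and> col p p' \<and> col p p'')"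
    using xy unfolding crossed_def by (elim exE conjE) (rule that; assumption)
  have Q: "u \<in> Q" if "u \<in> L \<or> u \<in> L'" for u using that L L' line_in_cube by blast
  have "T p \<in> T ` L' \<or> (\<exists>p'\<in>T ` L'. \<exists>p''\<in>T ` L'. p' \<noteq> p'' \<and> p' \<notin> C \<and> p'' \<notin> C \<and> col (T p) p' \<and> col (T p) p'')"
    using alt
  proof
    assume "\<exists>p'\<in>L'. \<exists>p''\<in>L'. p' \<noteq> p'' \<and> p' \<notin> C \<and> p'' \<notin> C \<and> col p p' \<and> col p p''"
    then obtain p' p'' where "p' \<in> L'" "p'' \<in> L'" "p' \<noteq> p''" "p' \<notin> C" "p'' \<notin> C" "col p p'" "col p p''" by blast
    then have "T p' \<in> T ` L'" "T p'' \<in> T ` L'" "T p' \<noteq> T p''" "T p' \<notin> C" "T p'' \<notin> C" "col (T p) (T p')" "col (T p) (T p'')"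
      using TC Q LP_eq_iff[OF T] LP_col[OF T] by auto
    then show ?thesis by blast
  qed blast
  moreover have "T ` L' \<noteq> T ` L" using inj_onD[OF LP_inj_on_lines[OF T]] L L' by blast
  moreover have "T a \<in> C" "T b \<in> C" "T a \<noteq> T b" "T p \<notin> C"
    using L' p TC Q LP_eq_iff[OF T] by auto
  ultimately show ?thesis
    unfolding crossed_def using LP_line[OF T L(1)] LP_line[OF T L'(1)] L L' p
    by (intro exI[of _ "T ` L"] exI[of _ "T ` L'"] exI[of _ "T a"] exI[of _ "T b"] exI[of _ "T p"]) auto
qed

text \<open>At an active coordinate the two corners already take the extreme values \<open>0\<close>
  and \<open>opp 0\<close>, so an inner point has neither; an inactive coordinate is extreme like
  those of the corners.\<close>

lemma corner_line_coord:
  assumes L: "line L" "a \<in> C" "b \<in> C" "a \<in> L" "b \<in> L" "a \<noteq> b" and z: "z \<in> L" "z \<notin> C" and i: "i < d"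
  shows "i \<in> supp L \<longleftrightarrow> z ! i \<noteq> 0 \<and> z ! i \<noteq> opp 0"
proof
  assume s: "i \<in> supp L"
  have "z ! i \<noteq> a ! i" "z ! i \<noteq> b ! i" "a ! i \<noteq> b ! i" using line_inj[OF L(1) s] L z by blast+
  then show "z ! i \<noteq> 0 \<and> z ! i \<noteq> opp 0" using L(2,3) i unfolding corners_iff by metis
next
  assume c: "z ! i \<noteq> 0 \<and> z ! i \<noteq> opp 0"
  then have "z ! i \<noteq> a ! i" using L(2) i unfolding corners_iff by metis
  then show "i \<in> supp L" using suppI[OF i z(1) L(4)] by blast
qed

text \<open>An inner point of an edge is non-extreme only in the edge direction \<open>i\<close>.
  Joining it to an inner point of another line spanned by corners preserves coordinate
  \<open>i\<close>, and that line has at most one such point.\<close>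

lemma adj_not_crossed:
  assumes x: "x \<in> C" and y: "y \<in> C" and adj: "adj x y"
  shows "\<not> crossed x y"
proof
  assume "crossed x y"
  then obtain L L' a b p where L: "line L" "x \<in> L" "y \<in> L" and L': "line L'" "a \<in> C" "b \<in> C"
    "a \<in> L'" "b \<in> L'" "a \<noteq> b" "L' \<noteq> L" and p: "p \<in> L" "p \<notin> C"
    and alt: "p \<in> L' \<or> (\<exists>p'\<in>L'. \<exists>p''\<in>L'. p' \<noteq> p'' \<and> p' \<notin> C \<and> p'' \<notin> C \<and> col p p' \<and> col p p'')"
    unfolding crossed_def by (elim exE conjE) (rule that; assumption)
  obtain i where i: "i < d" "x ! i \<noteq> y ! i" "\<And>j. j < d \<Longrightarrow> j \<noteq> i \<Longrightarrow> x ! j = y ! j"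
    using adj unfolding adj_def by blast
  have xy: "x \<noteq> y" using i by blast
  have sL: "supp L = {i}" using line_supp_eq[OF L xy] i by auto
  note pc = corner_line_coord[OF L(1) x y L(2,3) xy p, unfolded sL]
  note uc = corner_line_coord[OF L'(1-6)]
  have pi: "p ! i \<noteq> 0" "p ! i \<noteq> opp 0" using pc[OF i(1)] by auto
  have pj: "p ! j = 0 \<or> p ! j = opp 0" if "j < d" "j \<noteq> i" for j using pc[OF that(1)] that by auto
  \<comment> \<open>Such a \<open>u\<close> is non-extreme at most at \<open>i\<close>, so
    \<open>L'\<close> varies only in \<open>i\<close> and agrees with \<open>L\<close> elsewhere,
    which makes the lines equal.\<close>
  have same: False if u: "u \<in> L'" "u \<notin> C" "\<And>j. j < d \<Longrightarrow> j \<noteq> i \<Longrightarrow> u ! j = p ! j" for u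
  proof -
    have "supp L' \<subseteq> {i}"
    proof
      fix j assume j: "j \<in> supp L'"
      show "j \<in> {i}" using uc[OF u(1,2) supp_less[OF j]] j pj[OF supp_less[OF j]] u(3)[OF supp_less[OF j]]
        by (cases "j = i") auto
    qed
    then have sL': "j \<notin> supp L'" if "j \<noteq> i" for j using that by blast
    have mem: "c \<in> L" if c: "c \<in> L'" for c
    proof -
      obtain z where z: "z \<in> L" "z ! i = c ! i"
        using line_ex[OF L(1), of i "c ! i"] sL cube_nth[OF line_in_cube[OF L'(1) c] i(1)] by auto
      have "z = c"
      proof (rule cube_eqI[OF line_in_cube[OF L(1) z(1)] line_in_cube[OF L'(1) c]])
        fix j assume j: "j < d"
        show "z ! j = c ! j"
        proof (cases "j = i")
          case False
          have "z ! j = p ! j" using supp_const[OF j _ z(1) p(1)] sL False by auto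
          also have "\<dots> = u ! j" using u(3)[OF j False] by simp
          also have "\<dots> = c ! j" using supp_const[OF j sL'[OF False] u(1) c] .
          finally show ?thesis .
        qed (use z in simp)
      qed
      then show ?thesis using z by simp
    qed
    show False using line_unique[OF L'(1) L(1) L'(6,4,5) mem mem] L' by blast
  qed
  \<comment> \<open>A change at some \<open>j\<close> other than \<open>i\<close> starts from an
    extreme value, so \<open>k\<close> is extreme; the non-extreme \<open>p ! i\<close> then cannot
    change.\<close>
  have dich: "(\<forall>j<d. j \<noteq> i \<longrightarrow> u ! j = p ! j) \<or> u ! i = p ! i" if u: "u \<in> L'" "col p u" for u
  proof (rule ccontr)
    assume "\<not> ?thesis"
    then obtain j where j: "j < d" "j \<noteq> i" "u ! j \<noteq> p ! j" and ui: "u ! i \<noteq> p ! i" by blast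
    obtain k l where kl: "\<And>i. i < d \<Longrightarrow> p ! i = u ! i \<or> p ! i = k \<and> u ! i = l \<or> p ! i = opp k \<and> u ! i = opp l" "k < n"
      using col_coords[OF u(2) line_in_cube[OF L(1) p(1)] line_in_cube[OF L'(1) u(1)]] by blast
    have "k = 0 \<or> k = opp 0" using kl(1)[OF j(1)] j(3) pj[OF j(1,2)] by (metis kl(2) opp_opp opp_opp_0)
    then show False using kl(1)[OF i(1)] ui pi by auto
  qed
  show False
  proof (cases "p \<in> L'")
    case True
    then show False using same[of p] p by blast
  next
    case False
    then obtain p' p'' where q: "p' \<in> L'" "p'' \<in> L'" "p' \<noteq> p''" "p' \<notin> C" "p'' \<notin> C" "col p p'" "col p p''" using alt by blast
    then have eq: "p' ! i = p ! i" "p'' ! i = p ! i" using dich same by blast+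
    then have "i \<in> supp L'" using uc[OF q(1,4) i(1)] pi by simp
    then show False using line_inj[OF L'(1) _ q(1,2), of i] eq q(3) by simp
  qed
qed

lemma corner_flip:
  assumes "x \<in> C"
  shows "x[j := opp (x ! j)] \<in> C"
proof -
  have Q: "x[j := opp (x ! j)] \<in> Q" using assms by (intro cube_update corner_in_cube) auto
  have "x[j := opp (x ! j)] ! i = 0 \<or> x[j := opp (x ! j)] ! i = opp 0" if "i < d" for i
    using that assms unfolding corners_iff by (cases "i = j") (auto simp: cube_iff)
  with Q show ?thesis by (simp add: corners_iff)
qed

lemma not_adj_crossed:
  assumes x: "x \<in> C" and y: "y \<in> C" and xy: "x \<noteq> y" and nadj: "\<not> adj x y"
  shows "crossed x y"
proof -
  obtain i where i: "i < d" "x ! i \<noteq> y ! i" using cube_neqE x y xy corner_in_cube by metis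
  obtain j where j: "j < d" "j \<noteq> i" "x ! j \<noteq> y ! j" using nadj i unfolding adj_def by blast
  \<comment> \<open>The crossing line is the given one with the direction of coordinate \<open>j\<close> reversed.\<close>
  define x' y' where "x' = x[j := opp (x ! j)]" and "y' = y[j := opp (y ! j)]"
  have C': "x' \<in> C" "y' \<in> C" unfolding x'_def y'_def using corner_flip x y by auto
  have len: "length x = d" "length y = d" using x y by (auto simp: corners_iff cube_iff)
  have nth: "x' ! a = (if a = j then opp (x ! j) else x ! a)" "y' ! a = (if a = j then opp (y ! j) else y ! a)"
    if "a < d" for a using that len by (auto simp: x'_def y'_def)
  have oj: "opp (x ! j) \<noteq> opp (y ! j)" "opp (x ! j) \<noteq> x ! j"
    using j x y opp_0_neq unfolding corners_iff by (metis opp_opp_0)+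
  have x'y': "x' \<noteq> y'" using nth[OF i(1)] i j by auto
  obtain L where L: "line L" "x \<in> L" "y \<in> L" "supp L = {a. a < d \<and> x ! a \<noteq> y ! a}"
    using corner_line[OF x y xy] .
  obtain L' where L': "line L'" "x' \<in> L'" "y' \<in> L'" "supp L' = {a. a < d \<and> x' ! a \<noteq> y' ! a}"
    using corner_line[OF C' x'y'] .
  have "x' ! a \<noteq> y' ! a \<longleftrightarrow> x ! a \<noteq> y ! a" if "a < d" for a
    using nth[OF that] oj j by (cases "a = j") simp_all
  then have S: "supp L' = supp L" unfolding L(4) L'(4) by auto
  have iS: "i \<in> supp L" and jS: "j \<in> supp L" using i j L(4) by auto
  have ne: "L' \<noteq> L"
  proof
    assume "L' = L"
    then have "x' = x" using line_inj[OF L(1) iS _ L(2)] L'(2) nth[OF i(1)] j by auto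
    then show False using nth(1)[OF j(1)] oj by simp
  qed
  have n1: "1 < n" using n3 by simp
  have one: "1 \<noteq> (0::nat)" "1 \<noteq> opp 0" "opp 1 \<noteq> 0" "opp 1 \<noteq> opp 0" using n3 by (auto simp: opp_def)
  obtain p where p: "p \<in> L" "p ! i = 1" using line_ex[OF L(1) iS n1] .
  obtain p' where p': "p' \<in> L'" "p' ! i = 1" using line_ex[OF L'(1) iS[folded S] n1] .
  obtain p'' where p'': "p'' \<in> L'" "p'' ! i = opp 1" using line_ex[OF L'(1) iS[folded S], of "opp 1"] by auto
  have nC: "p \<notin> C" "p' \<notin> C" "p'' \<notin> C" using p p' p'' one i(1) by (auto simp: corners_iff)
  have pS: "p ! a = 1 \<or> p ! a = opp 1" if "a \<in> supp L" for a
    using line_coord[OF L(1) iS that p(1)] p(2) by simp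
  have uS: "u ! a = 1 \<or> u ! a = opp 1" if "u \<in> L'" "u ! i = 1 \<or> u ! i = opp 1" "a \<in> supp L" for u a
    using line_coord[OF L'(1), of i a u] iS S that opp_opp[OF n1] by metis
  have off: "u ! a = p ! a" if "u \<in> L'" "a < d" "a \<notin> supp L" for u a
  proof -
    have "u ! a = x' ! a" using supp_const[OF that(2) _ that(1) L'(2)] S that by simp
    also have "\<dots> = x ! a" using nth(1)[OF that(2)] that jS by auto
    also have "\<dots> = p ! a" using supp_const[OF that(2,3) L(2) p(1)] .
    finally show ?thesis .
  qed
  \<comment> \<open>On the common active set both points have only the values \<open>1\<close> and
    \<open>opp 1\<close>, and elsewhere they agree, so the pair \<open>1\<close>,
    \<open>opp 1\<close> witnesses collinearity.\<close>
  have col: "col p u" if u: "u \<in> L'" "u ! i = 1 \<or> u ! i = opp 1" for u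
  proof (rule colI[OF line_in_cube[OF L(1) p(1)] line_in_cube[OF L'(1) u(1)] n1, of "opp 1"])
    fix a assume a: "a < d"
    show "p ! a = u ! a \<or> p ! a = 1 \<and> u ! a = opp 1 \<or> p ! a = opp 1 \<and> u ! a = opp (opp 1)"
      using pS[of a] uS[OF u, of a] off[OF u(1) a] opp_opp[OF n1] by metis
  qed simp
  have "p \<in> L' \<or> (\<exists>p'\<in>L'. \<exists>p''\<in>L'. p' \<noteq> p'' \<and> p' \<notin> C \<and> p'' \<notin> C \<and> col p p' \<and> col p p'')"
  proof (cases "opp 1 = 1")
    \<comment> \<open>Now \<open>n = 3\<close>: the value \<open>1\<close> is central and the two
      lines meet in \<open>p\<close>.\<close>
    case True
    have "p ! a = p' ! a" if a: "a < d" for a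
      using pS[of a] uS[OF p'(1) disjI1[OF p'(2)], of a] off[OF p'(1) a] True by metis
    then have "p = p'" by (intro cube_eqI[OF line_in_cube[OF L(1) p(1)] line_in_cube[OF L'(1) p'(1)]])
    then show ?thesis using p' by simp
  next
    case False
    then have "p' \<noteq> p''" using p' p'' by auto
    then show ?thesis using p' p'' nC col by blast
  qed
  then show ?thesis unfolding crossed_def using L L' ne C' x'y' p(1) nC(1) by blast
qed

text \<open>Non-adjacent images would be crossed, and the inverse, which preserves corners as well,
  would carry the crossing back to the edge from \<open>x\<close> to \<open>y\<close>.\<close>

lemma LP_adj:
  assumes T: "T \<in> LP" and TC: "\<And>x. x \<in> C \<Longrightarrow> T x \<in> C" and x: "x \<in> C" and y: "y \<in> C" and adj: "adj x y"
  shows "adj (T x) (T y)"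
proof (rule ccontr)
  assume nadj: "\<not> adj (T x) (T y)"
  obtain S where S: "S \<in> LP" "\<And>x. x \<in> Q \<Longrightarrow> S (T x) = x" "\<And>x. x \<in> Q \<Longrightarrow> T (S x) = x"
    using LP_inverse[OF T] by blast
  have Q: "x \<in> Q" "y \<in> Q" using x y corner_in_cube by auto
  have "x \<noteq> y" using adj by (auto simp: adj_def)
  then have "T x \<noteq> T y" using LP_eq_iff[OF T Q] by simp
  then have "crossed (T x) (T y)" using not_adj_crossed TC x y nadj by blast
  moreover have "S u \<in> C \<longleftrightarrow> u \<in> C" if "u \<in> Q" for u
    using LP_corner_iff[OF T TC LP_in_cube[OF S(1) that]] S(3)[OF that] by simp
  ultimately have "crossed (S (T x)) (S (T y))" using LP_crossed[OF S(1)] by blast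
  then show False using adj_not_crossed[OF x y adj] S(2) Q by simp
qed

subsection \<open>Fixing the corners\<close>

text \<open>Signed coordinate permutations. Surjectivity of \<open>\<sigma>\<close> provides an
  output coordinate that reads an active coordinate of the line, so the image is not
  constant.\<close>

lemma LP_coordI:
  assumes B: "f \<in> Bij Q" and s: "\<sigma> ` {..<d} = {..<d}"
    and f: "\<And>a. a < d \<Longrightarrow> (\<forall>x\<in>Q. f x ! a = x ! \<sigma> a) \<or> (\<forall>x\<in>Q. f x ! a = opp (x ! \<sigma> a))"
  shows "f \<in> LP"
proof -
  have "line (f ` L)" if L: "line L" for L
  proof -
    obtain j where j: "j \<in> supp L" using line_supp_nonempty[OF L] .
    then have "j \<in> \<sigma> ` {..<d}" using s supp_less by blast
    then obtain i where i: "i < d" "\<sigma> i = j" by blast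
    have LQ: "y \<in> Q" if "y \<in> L" for y using line_in_cube[OF L that] .
    show ?thesis
    proof (rule line_image_coords[OF L _ _ i(1)])
      show "f y \<in> Q" if "y \<in> L" for y using B LQ[OF that] by (auto simp: Bij_def bij_betw_def)
      show "(\<exists>c. \<forall>y\<in>L. f y ! a = c) \<or>
        (\<exists>j\<in>supp L. (\<forall>y\<in>L. f y ! a = y ! j) \<or> (\<forall>y\<in>L. f y ! a = opp (y ! j)))" if a: "a < d" for a
      proof (cases "\<sigma> a \<in> supp L")
        case True then show ?thesis using f[OF a] LQ by blast
      next
        case False
        obtain z where z: "z \<in> L" using line_ex[OF L j, of 0] n3 by auto
        have "\<sigma> a < d" using s a by blast
        then have "y ! \<sigma> a = z ! \<sigma> a" if "y \<in> L" for y using supp_const[OF _ False that z] by simp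
        then show ?thesis using f[OF a] LQ by metis
      qed
      show "\<not> (\<exists>c. \<forall>y\<in>L. f y ! i = c)"
      proof
        assume "\<exists>c. \<forall>y\<in>L. f y ! i = c"
        then obtain c where c: "\<And>y. y \<in> L \<Longrightarrow> f y ! i = c" by blast
        obtain y z where yz: "y \<in> L" "z \<in> L" "y ! j \<noteq> z ! j" using j unfolding supp_def by blast
        then have "y ! j = z ! j \<or> opp (y ! j) = opp (z ! j)" using f[OF i(1)] c LQ i(2) by metis
        then show False using yz opp_inj cube_nth[OF LQ supp_less[OF j]] by blast
      qed
    qed
  qed
  then show ?thesis using B by (simp add: line_perms_def)
qed

section \<open>Reflections and transpositions of coordinates in the group\<close>

definition flip :: "nat \<Rightarrow> nat list \<Rightarrow> nat list" where
  "flip i = (\<lambda>x\<in>Q. x[i := opp (x ! i)])"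

definition swap :: "nat \<Rightarrow> nat \<Rightarrow> nat list \<Rightarrow> nat list" where
  "swap i j = (\<lambda>x\<in>Q. x[i := x ! j, j := x ! i])"

lemma flip_nth: "x \<in> Q \<Longrightarrow> a < d \<Longrightarrow> flip i x ! a = (if a = i then opp (x ! i) else x ! a)"
  by (auto simp: flip_def cube_iff)

lemma swap_nth:
  "x \<in> Q \<Longrightarrow> a < d \<Longrightarrow> swap i j x ! a = (if a = j then x ! i else if a = i then x ! j else x ! a)"
  by (auto simp: swap_def cube_iff nth_list_update)

lemma rot_nth:
  "x \<in> Q \<Longrightarrow> a < d \<Longrightarrow> rot n d i j x ! a = (if a = j then x ! i else if a = i then opp (x ! j) else x ! a)"
  by (auto simp: rot_def cube_iff nth_list_update opp_def)

lemma swap_last_nth: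
  "x \<in> Q \<Longrightarrow> a < d \<Longrightarrow>
    swap_last n d x ! a = (if a = d - 1 then x ! (d - 2) else if a = d - 2 then x ! (d - 1) else x ! a)"
  by (auto simp: swap_last_def cube_iff nth_list_update)

lemma flip_cube: "x \<in> Q \<Longrightarrow> flip i x \<in> Q"
  by (simp add: flip_def cube_update)

lemma swap_cube: "x \<in> Q \<Longrightarrow> i < d \<Longrightarrow> j < d \<Longrightarrow> swap i j x \<in> Q"
  by (simp add: swap_def cube_update cube_nth)

lemma Bij_in_cube: "f \<in> Bij Q \<Longrightarrow> x \<in> Q \<Longrightarrow> f x \<in> Q"
  by (auto simp: Bij_def bij_betw_def)

lemma G_if_coords_eq:
  assumes "A \<in> G" "f \<in> extensional Q" "\<And>x. x \<in> Q \<Longrightarrow> f x \<in> Q"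
    and "\<And>x a. x \<in> Q \<Longrightarrow> a < d \<Longrightarrow> f x ! a = A x ! a"
  shows "f \<in> G"
proof -
  have "f = A"
  proof (rule extensionalityI[OF assms(2)])
    show "A \<in> extensional Q" using G_Bij[OF assms(1)] by (simp add: Bij_def)
    show "f x = A x" if "x \<in> Q" for x
      using cube_eqI[OF assms(3)[OF that] Bij_in_cube[OF G_Bij[OF assms(1)] that]] assms(4)[OF that] by blast
  qed
  then show ?thesis using assms by simp
qed

text \<open>The rotation exchanges the last two coordinates and reflects one; the swap undoes the
  exchange and leaves the reflection.\<close>

lemma flip_last_G: "flip (d - 1) \<in> G"
proof (rule G_if_coords_eq)
  have d: "d - 2 < d" "d - 1 < d" "d - 2 \<noteq> d - 1" using d2 by auto
  show "compose Q (swap_last n d) (rot n d (d - 2) (d - 1)) \<in> G"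
    by (intro G_compose G_swap G_rot d)
  fix x a assume x: "x \<in> Q" and a: "a < d"
  have "rot n d (d - 2) (d - 1) x \<in> Q" using Bij_in_cube[OF rot_Bij x] d by blast
  then show "flip (d - 1) x ! a = compose Q (swap_last n d) (rot n d (d - 2) (d - 1)) x ! a"
    using d a x by (auto simp: compose_nth swap_last_nth rot_nth flip_nth)
qed (auto simp: flip_cube, simp add: flip_def)

text \<open>Conjugation of the last reflection by the rotation that carries coordinate
  \<open>i\<close> to the last position.\<close>

lemma flip_G:
  assumes i: "i < d"
  shows "flip i \<in> G"
proof (cases "i = d - 1")
  case False
  let ?A = "compose Q (rot n d (d - 1) i) (compose Q (flip (d - 1)) (rot n d i (d - 1)))"
  show ?thesis
  proof (rule G_if_coords_eq)
    have d: "d - 1 < d" using d2 by simp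
    show "?A \<in> G" using False i d by (intro G_compose flip_last_G G_rot) auto
    fix x a assume x: "x \<in> Q" and a: "a < d"
    have r: "rot n d i (d - 1) x \<in> Q" using Bij_in_cube[OF rot_Bij x] d i False by blast
    then have "flip (d - 1) (rot n d i (d - 1) x) \<in> Q" by (rule flip_cube)
    then show "flip i x ! a = ?A x ! a"
      using d a x i False r cube_nth[OF x] by (auto simp: compose_nth rot_nth flip_nth)
  qed (auto simp: flip_cube, simp add: flip_def)
qed (simp only: flip_last_G)

text \<open>A rotation is a transposition up to one reflection, which \<open>flip i\<close>
  removes.\<close>

lemma swap_G:
  assumes "i < d" "j < d" "i \<noteq> j"
  shows "swap i j \<in> G"
proof (rule G_if_coords_eq)
  show "compose Q (flip i) (rot n d i j) \<in> G" using assms by (intro G_compose flip_G G_rot)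
  fix x a assume x: "x \<in> Q" and a: "a < d"
  have "rot n d i j x \<in> Q" using Bij_in_cube[OF rot_Bij x] assms by blast
  then show "swap i j x ! a = compose Q (flip i) (rot n d i j) x ! a"
    using a x assms cube_nth[OF x] by (auto simp: compose_nth rot_nth flip_nth swap_nth)
qed (use assms in \<open>auto simp: swap_cube\<close>, simp add: swap_def)

lemma flip_LP: "i < d \<Longrightarrow> flip i \<in> LP"
  by (rule LP_coordI[of _ id]) (auto simp: flip_nth intro: G_Bij flip_G)

lemma swap_LP:
  assumes "i < d" "j < d" "i \<noteq> j"
  shows "swap i j \<in> LP"
proof (rule LP_coordI[of _ "transpose i j"])
  show "transpose i j ` {..<d} = {..<d}" using assms by (intro permutes_image permutes_swap_id) auto
  show "(\<forall>x\<in>Q. swap i j x ! a = x ! transpose i j a) \<or> (\<forall>x\<in>Q. swap i j x ! a = opp (x ! transpose i j a))"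
    if "a < d" for a
    using that assms by (auto simp: swap_nth transpose_def)
qed (use assms in \<open>auto intro: G_Bij swap_G\<close>)

lemma flip_corner: "x \<in> C \<Longrightarrow> flip i x \<in> C"
  by (simp add: flip_def corner_in_cube corner_flip)

lemma swap_corner:
  assumes "x \<in> C" "i < d" "j < d"
  shows "swap i j x \<in> C"
  using assms swap_cube by (auto simp: corners_iff swap_nth)

text \<open>Corrections are applied one after another; the existential records that together they
  form a single group element composed after \<open>T\<close>.\<close>

definition moves_to :: "(nat list \<Rightarrow> nat list) \<Rightarrow> (nat list \<Rightarrow> nat list) \<Rightarrow> bool" where
  "moves_to T T' \<longleftrightarrow> T' \<in> LP \<and> (\<exists>A\<in>G. T' = compose Q A T)"

lemma moves_to_refl:
  assumes "T \<in> LP"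
  shows "moves_to T T"
proof -
  have "compose Q (\<lambda>x\<in>Q. x) T = T"
    using assms by (intro Id_compose) (auto simp: line_perms_def Bij_def bij_betw_def)
  then show ?thesis unfolding moves_to_def using assms G_id by metis
qed

lemma moves_to_step:
  assumes T: "T \<in> LP" and TT': "moves_to T T'" and A: "A \<in> G" "A \<in> LP"
  shows "moves_to T (compose Q A T')"
proof -
  obtain B where B: "B \<in> G" "T' = compose Q B T" and T': "T' \<in> LP" using TT' by (auto simp: moves_to_def)
  have "compose Q A T' = compose Q (compose Q A B) T"
    unfolding B(2) using LP_in_cube[OF T] by (intro compose_assoc) auto
  then show ?thesis unfolding moves_to_def using compose_LP[OF A(2) T'] G_compose[OF A(1) B(1)] by blast
qed

lemma moves_to_corners:
  assumes T: "T \<in> LP"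
  obtains T' where "moves_to T T'" "\<And>x. x \<in> C \<Longrightarrow> T' x \<in> C"
proof -
  obtain A where A: "A \<in> G" "A \<in> LP" "\<And>x. x \<in> C \<Longrightarrow> A (T x) \<in> C" using LP_move_corners[OF T] by blast
  show ?thesis
    using that[OF moves_to_step[OF T moves_to_refl[OF T] A(1,2)]] A(3) by (simp add: compose_nth corner_in_cube)
qed

abbreviation origin where "origin \<equiv> replicate d (0::nat)"

lemma origin_corner: "origin \<in> C" using n3 by (auto simp: corners_iff cube_iff)

text \<open>The reflection \<open>flip k\<close> changes only coordinate \<open>k\<close> of the
  image of the origin, so coordinates already made \<open>0\<close> survive.\<close>

lemma moves_to_origin:
  assumes T: "T \<in> LP"
  obtains T' where "moves_to T T'" "\<And>x. x \<in> C \<Longrightarrow> T' x \<in> C" "T' origin = origin"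
proof -
  have "\<exists>T'. moves_to T T' \<and> (\<forall>x\<in>C. T' x \<in> C) \<and> (\<forall>i<k. T' origin ! i = 0)" if "k \<le> d" for k
    using that
  proof (induction k)
    case 0
    show ?case using moves_to_corners[OF T] by (metis less_nat_zero_code)
  next
    case (Suc k)
    then obtain T' where T': "moves_to T T'" "\<forall>x\<in>C. T' x \<in> C" "\<forall>i<k. T' origin ! i = 0" by auto
    have kd: "k < d" using Suc by simp
    have c: "T' origin \<in> C" using T'(2) origin_corner by blast
    show ?case
    proof (cases "T' origin ! k = 0")
      case True
      then show ?thesis using T' by (metis less_Suc_eq)
    next
      case False
      then have k: "T' origin ! k = opp 0" using c kd by (auto simp: corners_iff)
      let ?T = "compose Q (flip k) T'"
      have "moves_to T ?T" using moves_to_step[OF T T'(1) flip_G flip_LP] kd by blast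
      moreover have "\<forall>x\<in>C. ?T x \<in> C" using T'(2) by (simp add: compose_nth corner_in_cube flip_corner)
      moreover have "?T origin ! i = 0" if "i < Suc k" for i
        using that kd k T'(3) origin_corner c
        by (cases "i = k") (auto simp: compose_nth corner_in_cube flip_nth)
      ultimately show ?thesis by blast
    qed
  qed
  from this[of d] obtain T' where T': "moves_to T T'" "\<forall>x\<in>C. T' x \<in> C" "\<forall>i<d. T' origin ! i = 0" by auto
  have "T' origin = origin" using T' origin_corner by (intro cube_eqI corner_in_cube) auto
  then show ?thesis using that T' by blast
qed

definition E :: "nat \<Rightarrow> nat list" where "E i = origin[i := opp 0]"

lemma E_nth: "a < d \<Longrightarrow> E i ! a = (if a = i then opp 0 else 0)" by (simp add: E_def)

lemma E_corner: "E i \<in> C"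
proof -
  have "E i \<in> Q" unfolding E_def by (intro cube_update corner_in_cube origin_corner) simp
  then show ?thesis by (auto simp: corners_iff E_nth)
qed

lemma adj_origin_E: "i < d \<Longrightarrow> adj origin (E i)"
  unfolding adj_def using opp_0_neq by (intro exI[of _ i]) (auto simp: E_nth)

lemma adj_origin:
  assumes "x \<in> C" "adj origin x"
  obtains i where "i < d" "x = E i"
proof -
  obtain i where i: "i < d" "origin ! i \<noteq> x ! i" "\<And>j. j < d \<Longrightarrow> j \<noteq> i \<Longrightarrow> origin ! j = x ! j"
    using assms(2) by (auto simp: adj_def)
  have "x = E i" using assms(1) i E_corner by (intro cube_eqI corner_in_cube) (auto simp: E_nth corners_iff)
  then show ?thesis using that i by blast
qed

lemma moves_to_axes:
  assumes T: "T \<in> LP"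
  obtains T' where "moves_to T T'" "\<And>x. x \<in> C \<Longrightarrow> T' x \<in> C" "T' origin = origin" "\<And>i. i < d \<Longrightarrow> T' (E i) = E i"
proof -
  have "\<exists>T'. moves_to T T' \<and> (\<forall>x\<in>C. T' x \<in> C) \<and> T' origin = origin \<and> (\<forall>i<k. T' (E i) = E i)" if "k \<le> d" for k
    using that
  proof (induction k)
    case 0
    show ?case using moves_to_origin[OF T] by (metis less_nat_zero_code)
  next
    case (Suc k)
    then obtain T' where T': "moves_to T T'" "\<And>x. x \<in> C \<Longrightarrow> T' x \<in> C" "T' origin = origin" "\<And>i. i < k \<Longrightarrow> T' (E i) = E i" by auto
    have L: "T' \<in> LP" using T'(1) by (simp add: moves_to_def)
    have kd: "k < d" using Suc by simp
    have "adj (T' origin) (T' (E k))" using LP_adj[OF L T'(2) origin_corner E_corner adj_origin_E[OF kd]] .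
    then obtain m where m: "m < d" "T' (E k) = E m" using adj_origin[OF T'(2)[OF E_corner]] T'(3) by metis
    show ?case
    proof (cases "m = k")
      case True
      then show ?thesis using T' m by (metis less_Suc_eq)
    next
      case False
      \<comment> \<open>For \<open>m < k\<close> the point \<open>E m\<close> is already its own
        image, against injectivity. Hence the transposition of \<open>k\<close> and \<open>m\<close>
        leaves the earlier \<open>E i\<close> alone.\<close>
      have "\<not> m < k"
      proof
        assume mk: "m < k"
        then have "T' (E m) = T' (E k)" using T'(4) m by simp
        then have "E m = E k" using LP_eq_iff[OF L] corner_in_cube[OF E_corner] by blast
        then have "E m ! m = E k ! m" by simp
        then show False using E_nth[OF m(1)] False opp_0_neq by simp
      qed
      then have km: "k < m" using False by simp
      let ?T = "compose Q (swap k m) T'"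
      have sw: "swap k m x = y" if "x \<in> C" "y \<in> C"
        "\<And>a. a < d \<Longrightarrow> (if a = m then x ! k else if a = k then x ! m else x ! a) = y ! a" for x y
        using that swap_corner[OF that(1) kd m(1)] swap_nth[OF corner_in_cube[OF that(1)]]
        by (intro cube_eqI corner_in_cube) auto
      have "moves_to T ?T" using moves_to_step[OF T T'(1) swap_G swap_LP] kd m km by blast
      moreover have "\<forall>x\<in>C. ?T x \<in> C" using T'(2) swap_corner kd m by (simp add: compose_nth corner_in_cube)
      moreover have "?T origin = origin"
        using sw[OF origin_corner origin_corner] T'(3) kd m by (auto simp: compose_nth corner_in_cube origin_corner)
      moreover have "?T (E i) = E i" if "i < Suc k" for i
      proof (cases "i = k")
        case True
        then show ?thesis using sw[OF E_corner[of m] E_corner[of k]] m kd km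
          by (auto simp: compose_nth corner_in_cube E_corner E_nth)
      next
        case False
        then have "i < k" using that by simp
        then show ?thesis using sw[OF E_corner[of i] E_corner[of i]] T'(4) m kd km
          by (auto simp: compose_nth corner_in_cube E_corner E_nth)
      qed
      ultimately show ?thesis by blast
    qed
  qed
  from this[of d] show ?thesis using that by auto
qed

lemma corner_update_0:
  assumes "x \<in> C"
  shows "x[i := 0] \<in> C"
proof -
  have "x[i := 0] \<in> Q" using assms n3 by (intro cube_update corner_in_cube) auto
  moreover have "x[i := 0] ! j = 0 \<or> x[i := 0] ! j = opp 0" if "j < d" for j
    using that assms by (cases "j = i") (auto simp: corners_iff cube_iff)
  ultimately show ?thesis by (simp add: corners_iff)
qed

text \<open>Induction on the number of nonzero coordinates, starting from the origin and its
  neighbours. A corner with two nonzero coordinates is pinned down by its adjacency to two corners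
  fixed earlier.\<close>

lemma LP_fixes_corners:
  assumes T: "T \<in> LP" and TC: "\<And>x. x \<in> C \<Longrightarrow> T x \<in> C" and TO: "T origin = origin"
    and TE: "\<And>i. i < d \<Longrightarrow> T (E i) = E i" and x: "x \<in> C"
  shows "T x = x"
  using x
proof (induction "card {i. i < d \<and> x ! i \<noteq> 0}" arbitrary: x rule: less_induct)
  case less
  let ?S = "\<lambda>x. {i. i < d \<and> x ! i \<noteq> 0}"
  have fin: "finite (?S x)" for x :: "nat list" by auto
  have len: "length x = d" using less.prems by (auto simp: corners_iff cube_iff)
  have low: "x[i := 0] \<in> C" "T (x[i := 0]) = x[i := 0]" if "i \<in> ?S x" for i
  proof -
    show c: "x[i := 0] \<in> C" using less.prems by (rule corner_update_0)
    have "?S (x[i := 0]) \<subset> ?S x" using that len by (auto simp: nth_list_update)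
    then show "T (x[i := 0]) = x[i := 0]" using less.hyps[OF psubset_card_mono[OF fin] c] by blast
  qed
  consider "?S x = {}" | i where "?S x = {i}" | i j where "i \<in> ?S x" "j \<in> ?S x" "i \<noteq> j" by blast
  then show ?case
  proof cases
    case 1
    then have "x = origin" using less.prems origin_corner by (intro cube_eqI corner_in_cube) auto
    then show ?thesis using TO by simp
  next
    case (2 i)
    then have S: "j < d \<and> x ! j \<noteq> 0 \<longleftrightarrow> j = i" for j by blast
    have "x ! j = E i ! j" if "j < d" for j
      using S[of j] less.prems that unfolding corners_iff E_nth[OF that] by metis
    then have "x = E i" using less.prems E_corner by (intro cube_eqI corner_in_cube) auto
    then show ?thesis using TE 2 by blast
  next
    case (3 i j)
    \<comment> \<open>The only common neighbours of \<open>x[i := 0]\<close> and \<open>x[j := 0]\<close> are \<open>x\<close> and \<open>x[i := 0, j := 0]\<close>.\<close>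
    let ?z = "x[i := 0, j := 0]"
    have xi: "x ! i = opp 0" "x ! j = opp 0" "i < d" "j < d" using 3 less.prems by (auto simp: corners_iff)
    have zC: "?z \<in> C" by (intro corner_update_0 less.prems)
    have "?S ?z \<subset> ?S x" using 3 len by (auto simp: nth_list_update)
    then have Tz: "T ?z = ?z" using less.hyps[OF psubset_card_mono[OF fin] zC] by blast
    have near: "adj (T x) (x[a := 0])" if a: "a \<in> ?S x" for a
    proof -
      have "adj x (x[a := 0])" unfolding adj_def using a len by (intro exI[of _ a]) auto
      from LP_adj[OF T TC less.prems low(1)[OF a] this] show ?thesis using low(2)[OF a] by simp
    qed
    have Tx: "T x \<in> C" using TC less.prems by blast
    have ne: "T x \<noteq> ?z"
    proof
      assume "T x = ?z"
      then have "x = ?z" using Tz LP_eq_iff[OF T] less.prems zC corner_in_cube by metis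
      moreover have "?z ! j = 0" using xi len by simp
      ultimately show False using xi opp_0_neq by metis
    qed
    obtain a where a: "a < d" "T x ! a \<noteq> x[i := 0] ! a" "\<And>b. b < d \<Longrightarrow> b \<noteq> a \<Longrightarrow> T x ! b = x[i := 0] ! b"
      using near[OF 3(1)] unfolding adj_def by blast
    obtain b where b: "b < d" "T x ! b \<noteq> x[j := 0] ! b" "\<And>c. c < d \<Longrightarrow> c \<noteq> b \<Longrightarrow> T x ! c = x[j := 0] ! c"
      using near[OF 3(2)] unfolding adj_def by blast
    have ij: "x[i := 0] ! i = 0" "x[j := 0] ! i = opp 0" "x[i := 0] ! j = opp 0" "x[j := 0] ! j = 0"
      using xi 3 len by auto
    \<comment> \<open>Otherwise coordinates \<open>i\<close> and \<open>j\<close> of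
      \<open>T x\<close> are both \<open>0\<close> and \<open>T x\<close> is the other common
      neighbour \<open>?z\<close>, which is already the image of itself.\<close>
    have "a = i"
    proof (rule ccontr)
      assume ai: "a \<noteq> i"
      then have Ti: "T x ! i = 0" using a(3)[OF xi(3)] ij by auto
      then have bi: "b = i" using b(3)[OF xi(3)] ij opp_0_neq by auto
      then have Tj: "T x ! j = 0" using b(3)[OF xi(4)] ij 3 by auto
      then have aj: "a = j" using a(3)[OF xi(4)] ij opp_0_neq by auto
      have "T x = ?z"
      proof (rule cube_eqI[OF corner_in_cube[OF Tx] corner_in_cube[OF zC]])
        fix c assume c: "c < d"
        show "T x ! c = ?z ! c"
          using a(3)[OF c] Ti Tj aj c len by (cases "c = i"; cases "c = j") auto
      qed
      then show False using ne by simp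
    qed
    show "T x = x"
    proof (rule cube_eqI[OF corner_in_cube[OF Tx] corner_in_cube[OF less.prems]])
      fix c assume c: "c < d"
      show "T x ! c = x ! c"
      proof (cases "c = i")
        case True
        then have "T x ! i = opp 0" using a(2) \<open>a = i\<close> ij(1) Tx xi(3) unfolding corners_iff by metis
        then show ?thesis using True xi by simp
      next
        case False
        then show ?thesis using a(3)[OF c] \<open>a = i\<close> by simp
      qed
    qed
  qed
qed

subsection \<open>Fixing the first axis\<close>

definition pt :: "nat \<Rightarrow> nat \<Rightarrow> nat list" where "pt a b = origin[0 := a, 1 := b]"

lemma pt_nth: "i < d \<Longrightarrow> pt a b ! i = (if i = 0 then a else if i = 1 then b else 0)"
  using d2 by (auto simp: pt_def nth_list_update)

lemma pt_nth_0 [simp]: "pt a b ! 0 = a" and pt_nth_1 [simp]: "pt a b ! Suc 0 = b"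
  using d2 pt_nth[of 0 a b] pt_nth[of 1 a b] by auto

lemma pt_cube: "a < n \<Longrightarrow> b < n \<Longrightarrow> pt a b \<in> Q"
  unfolding pt_def by (intro cube_update corner_in_cube origin_corner)

lemma pt_corner_iff:
  assumes "a < n" "b < n"
  shows "pt a b \<in> C \<longleftrightarrow> (a = 0 \<or> a = opp 0) \<and> (b = 0 \<or> b = opp 0)"
proof -
  have "0 < d" "Suc 0 < d" using d2 by auto
  then show ?thesis using pt_cube[OF assms] by (auto simp: corners_iff pt_nth)
qed

lemma pt_eq_iff: "pt a b = pt a' b' \<longleftrightarrow> a = a' \<and> b = b'"
  by (metis pt_nth_0 pt_nth_1)

text \<open>The three choices of \<open>f\<close> give the axis and the two diagonals of the plane
  of the first two coordinates. Each contains two fixed corners, so \<open>line_unique\<close> makes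
  it invariant.\<close>

lemma LP_plane_line:
  assumes T: "T \<in> LP" and fix_C: "\<And>x. x \<in> C \<Longrightarrow> T x = x"
    and f: "f = (\<lambda>i. 0) \<or> f = (\<lambda>i. i) \<or> f = opp" and i: "i < n"
  obtains a where "a < n" "T (pt i (f i)) = pt a (f a)"
proof -
  let ?L = "(\<lambda>k. pt k (f k)) ` {..<n}"
  have d0: "0 < d" using d2 by simp
  have n0: "0 < n" using n3 by simp
  have fn: "f k < n" if "k < n" for k using f that by auto
  have L: "line ?L"
  proof (rule lineI[OF _ _ d0])
    show "pt k (f k) \<in> Q" if "k < n" for k using pt_cube fn that by blast
    show "(\<forall>k<n. pt k (f k) ! i = k) \<or> (\<forall>k<n. pt k (f k) ! i = opp k) \<or> (\<exists>c. \<forall>k<n. pt k (f k) ! i = c)"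
      if "i < d" for i
      using f by (auto simp: pt_nth[OF that])
    show "\<not> (\<exists>c. \<forall>k<n. pt k (f k) ! 0 = c)"
    proof
      assume "\<exists>c. \<forall>k<n. pt k (f k) ! 0 = c"
      then obtain c where c: "\<forall>k<n. k = c" by auto
      have "0 = c" "opp 0 = c" using c n0 opp_less by blast+
      then show False using opp_0_neq by simp
    qed
  qed
  let ?x = "pt 0 (f 0)" and ?y = "pt (opp 0) (f (opp 0))"
  have xy: "?x \<in> C" "?y \<in> C" using pt_corner_iff fn n0 f by auto
  have ne: "?x \<noteq> ?y" using opp_0_neq pt_eq_iff by simp
  have in_L: "?x \<in> ?L" "?y \<in> ?L" using n0 by auto
  have "?x \<in> T ` ?L" "?y \<in> T ` ?L" using imageI[OF in_L(1), of T] imageI[OF in_L(2), of T] fix_C xy by simp_all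
  then have "T ` ?L = ?L" using line_unique[OF LP_line[OF T L] L ne] in_L by blast
  moreover have "T (pt i (f i)) \<in> T ` ?L" using i by blast
  ultimately have "T (pt i (f i)) \<in> ?L" by simp
  then show ?thesis using that by blast
qed

text \<open>The axis point and the diagonal point above it are collinear. Between an inner axis
  point and an inner diagonal point collinearity forces equal first coordinates, so both are moved
  by the same amount.\<close>

lemma LP_plane_diagonals:
  assumes T: "T \<in> LP" and fix_C: "\<And>x. x \<in> C \<Longrightarrow> T x = x" and i: "i < n"
    and f: "f = (\<lambda>i. i) \<or> f = opp" and a: "a < n" "T (pt i 0) = pt a 0"
  shows "T (pt i (f i)) = pt a (f a)"
proof (cases "i = 0 \<or> i = opp 0")
  case True
  have n0: "0 < n" using n3 by simp
  have fi: "f i < n" using f i by auto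
  have c: "pt i 0 \<in> C" "pt i (f i) \<in> C"
    using True f unfolding pt_corner_iff[OF i n0] pt_corner_iff[OF i fi] by auto
  then have "pt i 0 = pt a 0" using fix_C a(2) by metis
  then have "i = a" by (simp add: pt_eq_iff)
  then show ?thesis using fix_C[OF c(2)] by simp
next
  case False
  have n0: "0 < n" using n3 by simp
  have fn: "f k < n" if "k < n" for k using f that by auto
  have TC: "T x \<in> C \<longleftrightarrow> x \<in> C" if "x \<in> Q" for x using LP_corner_iff[OF T _ that] fix_C by simp
  obtain b where b: "b < n" "T (pt i (f i)) = pt b (f b)"
    using LP_plane_line[OF T fix_C _ i, of f] f by blast
  have "pt a 0 \<notin> C" using TC[OF pt_cube[OF i n0]] a False n0 i by (simp add: pt_corner_iff)
  then have ai: "a \<noteq> 0" "a \<noteq> opp 0" using a n0 by (auto simp: pt_corner_iff)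
  have "pt b (f b) \<notin> C" using TC[OF pt_cube[OF i fn[OF i]]] b False fn i by (simp add: pt_corner_iff)
  then have "\<not> ((b = 0 \<or> b = opp 0) \<and> (f b = 0 \<or> f b = opp 0))" using b fn by (simp add: pt_corner_iff)
  then have bi: "f b \<noteq> 0" "f b \<noteq> opp 0" using f b opp_eq_iff[OF b(1) n0] opp_inj[OF b(1) n0] by auto
  have "col (pt i 0) (pt i (f i))"
    by (rule colI[of _ _ 0 "f i"]) (use i n0 fn pt_cube in \<open>auto simp: pt_nth\<close>)
  then have col: "col (pt a 0) (pt b (f b))" using LP_col[OF T] a b by metis
  obtain k l where kl: "k < n" "\<And>i. i < d \<Longrightarrow> pt a 0 ! i = pt b (f b) ! i \<or>
      pt a 0 ! i = k \<and> pt b (f b) ! i = l \<or> pt a 0 ! i = opp k \<and> pt b (f b) ! i = opp l"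
    using col_coords[OF col pt_cube[OF a(1) n0] pt_cube[OF b(1) fn[OF b(1)]]] by blast
  \<comment> \<open>The second coordinate changes from \<open>0\<close>, so \<open>k\<close> is
    extreme; since \<open>a\<close> is not extreme, the first coordinate cannot change.\<close>
  have "0 = k \<or> 0 = opp k" using kl(2)[of 1] d2 bi by auto
  then have "k = 0 \<or> k = opp 0" using kl(1) opp_eq_iff n0 by metis
  moreover have "a = b \<or> a = k \<or> a = opp k" using kl(2)[of 0] d2 by auto
  ultimately have "a = b" using ai by auto
  then show ?thesis using b by simp
qed

text \<open>Both diagonals follow the permutation \<open>\<psi>\<close> of the axis. Comparing a
  point on one diagonal with the point at the same height on the other shows that
  \<open>\<psi>\<close> respects \<open>opp\<close>.\<close>

lemma LP_axis_permutation:
  assumes T: "T \<in> LP" and fix_C: "\<And>x. x \<in> C \<Longrightarrow> T x = x"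
  obtains \<psi> where "\<psi> permutes {..<n}" "\<And>k. k < n \<Longrightarrow> T (pt k 0) = pt (\<psi> k) 0"
    "\<And>k. k < n \<Longrightarrow> \<psi> (opp k) = opp (\<psi> k)" "\<psi> 0 = 0" "\<psi> (opp 0) = opp 0"
proof -
  have n0: "0 < n" using n3 by simp
  \<comment> \<open>Outside \<open>{..<n}\<close> the value is \<open>k\<close> itself, as
    \<open>permutes\<close> demands.\<close>
  define \<psi> where "\<psi> k = (if k < n then T (pt k 0) ! 0 else k)" for k
  have ax: "T (pt k 0) = pt (\<psi> k) 0" and pn: "\<psi> k < n" if k: "k < n" for k
  proof -
    obtain a where "a < n" "T (pt k 0) = pt a 0" using LP_plane_line[OF T fix_C _ k, of "\<lambda>i. 0"] by blast
    then show "T (pt k 0) = pt (\<psi> k) 0" "\<psi> k < n" using k by (auto simp: \<psi>_def)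
  qed
  have inj: "k = l" if "k < n" "l < n" "\<psi> k = \<psi> l" for k l
  proof -
    have "T (pt k 0) = T (pt l 0)" using ax that by simp
    then show ?thesis using LP_eq_iff[OF T pt_cube pt_cube] that n0 by (simp add: pt_eq_iff)
  qed
  have inj_on: "inj_on \<psi> {..<n}" using inj by (auto simp: inj_on_def)
  then have "\<psi> ` {..<n} = {..<n}" using pn by (intro endo_inj_surj) auto
  then have "bij_betw \<psi> {..<n} {..<n}" using inj_on by (simp add: bij_betw_def)
  then have perm: "\<psi> permutes {..<n}" by (rule bij_imp_permutes) (simp add: \<psi>_def)
  have corner: "\<psi> k = k" if "k = 0 \<or> k = opp 0" for k
  proof -
    have k: "k < n" using that n0 by auto
    have "T (pt k 0) = pt k 0" using fix_C pt_corner_iff[OF k n0] that by blast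
    then show ?thesis using ax[OF k] by (simp add: pt_eq_iff)
  qed
  have diag: "T (pt k k) = pt (\<psi> k) (\<psi> k)" if "k < n" for k
    using LP_plane_diagonals[OF T fix_C that, of "\<lambda>i. i"] ax[OF that] pn[OF that] by simp
  have anti: "T (pt k (opp k)) = pt (\<psi> k) (opp (\<psi> k))" if "k < n" for k
    using LP_plane_diagonals[OF T fix_C that, of opp] ax[OF that] pn[OF that] by simp
  \<comment> \<open>The middle point of the plane lies on both diagonals, and so does its
    image.\<close>
  have mid: "\<psi> k = opp (\<psi> k)" if "k < n" "opp k = k" for k
    using diag[OF that(1)] anti[OF that(1)] that(2) by (simp add: pt_eq_iff)
  have mid_unique: "k = l" if "k < n" "l < n" "opp k = k" "opp l = l" for k l
    using that unfolding opp_def by linarith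
  \<comment> \<open>A self-opposite \<open>\<psi> k\<close> is the unique middle value, which
    \<open>\<psi>\<close> fixes by \<open>mid\<close>; injectivity then makes \<open>k\<close> the
    middle value.\<close>
  have off_mid: "\<psi> k \<noteq> opp (\<psi> k)" if k: "k < n" "opp k \<noteq> k" for k
  proof
    assume *: "\<psi> k = opp (\<psi> k)"
    then have "\<psi> (\<psi> k) = \<psi> k" using mid_unique pn mid k(1) by metis
    then have "\<psi> k = k" using inj pn k(1) by blast
    then show False using * k by simp
  qed
  have sym: "\<psi> (opp k) = opp (\<psi> k)" if k: "k < n" for k
  proof (cases "opp k = k")
    case True
    then show ?thesis using mid[OF k] by simp
  next
    case False
    have ne: "\<psi> k \<noteq> \<psi> (opp k)" using inj[OF k opp_less] False by metis
    have "col (pt k k) (pt (opp k) k)"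
      by (rule colI[of _ _ k "opp k"]) (use k pt_cube in \<open>auto simp: pt_nth\<close>)
    then have c: "col (pt (\<psi> k) (\<psi> k)) (pt (\<psi> (opp k)) (opp (\<psi> (opp k))))"
      using LP_col[OF T, of "pt k k" "pt (opp k) k"] diag[OF k] anti[of "opp k"] k by simp
    obtain a b where ab: "a < n" "b < n" "\<And>i. i < d \<Longrightarrow>
        pt (\<psi> k) (\<psi> k) ! i = pt (\<psi> (opp k)) (opp (\<psi> (opp k))) ! i \<or>
        pt (\<psi> k) (\<psi> k) ! i = a \<and> pt (\<psi> (opp k)) (opp (\<psi> (opp k))) ! i = b \<or>
        pt (\<psi> k) (\<psi> k) ! i = opp a \<and> pt (\<psi> (opp k)) (opp (\<psi> (opp k))) ! i = opp b"
      using col_coords[OF c pt_cube pt_cube] pn k opp_less by blast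
    have 0: "\<psi> k = a \<and> \<psi> (opp k) = b \<or> \<psi> k = opp a \<and> \<psi> (opp k) = opp b"
      using ab(3)[of 0] ne d2 by auto
    have 1: "\<psi> k = opp (\<psi> (opp k)) \<or> \<psi> k = a \<and> opp (\<psi> (opp k)) = b \<or> \<psi> k = opp a \<and> opp (\<psi> (opp k)) = opp b"
      using ab(3)[of 1] d2 by auto
    have o: "opp (opp k) \<noteq> opp k" using False k by simp
    \<comment> \<open>The first coordinates differ by \<open>ne\<close>. Every combination of
      \<open>0\<close> and \<open>1\<close> other than the claim makes \<open>\<psi> k\<close> or
      \<open>\<psi> (opp k)\<close> self-opposite.\<close>
    have "\<psi> k = opp (\<psi> (opp k))"
      using 0 1 off_mid[OF k False] off_mid[OF opp_less o] ab(1,2) opp_opp by metis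
    then show ?thesis using pn[OF opp_less] by simp
  qed
  show ?thesis by (rule that[OF perm ax sym]) (simp_all add: corner)
qed

lemma first_axis_eq: "first_axis n d = (\<lambda>i. pt i 0) ` {..<n}"
proof -
  have "i # replicate (d - 1) 0 = pt i 0" for i
    using d2 by (intro nth_equalityI) (auto simp: pt_nth nth_Cons' , auto simp: pt_def)
  then show ?thesis by (auto simp: first_axis_def)
qed

text \<open>The inverse of the axis permutation also commutes with \<open>opp\<close>, so its
  coordinate map lies in the group and undoes the action on the axis. It keeps the corners fixed
  because \<open>\<psi>\<close> fixes \<open>0\<close> and \<open>opp 0\<close>.\<close>

lemma moves_to_fixing:
  assumes T: "T \<in> LP"
  obtains T' where "moves_to T T'" "\<And>x. x \<in> C \<Longrightarrow> T' x = x" "\<And>k. k < n \<Longrightarrow> T' (pt k 0) = pt k 0"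
proof -
  have n0: "0 < n" using n3 by simp
  obtain T' where T': "moves_to T T'" "\<And>x. x \<in> C \<Longrightarrow> T' x \<in> C" "T' origin = origin" "\<And>i. i < d \<Longrightarrow> T' (E i) = E i"
    using moves_to_axes[OF T] by blast
  have L: "T' \<in> LP" using T'(1) by (simp add: moves_to_def)
  have fix_C: "T' x = x" if "x \<in> C" for x using LP_fixes_corners[OF L T'(2-4) that] .
  obtain \<psi> where p: "\<psi> permutes {..<n}" and ax: "\<And>k. k < n \<Longrightarrow> T' (pt k 0) = pt (\<psi> k) 0"
    and sym: "\<And>k. k < n \<Longrightarrow> \<psi> (opp k) = opp (\<psi> k)" and p0: "\<psi> 0 = 0" "\<psi> (opp 0) = opp 0"
    using LP_axis_permutation[OF L fix_C] by blast
  let ?r = "inv_into UNIV \<psi>"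
  have r: "?r permutes {..<n}" by (rule permutes_inv[OF p])
  have rp: "?r (\<psi> k) = k" and pr: "\<psi> (?r k) = k" for k using permutes_inverses[OF p] by auto
  have pn: "\<psi> k < n" "?r k < n" if "k < n" for k
    using permutes_in_image[OF p, of k] permutes_in_image[OF r, of k] that by simp_all
  have r_sym: "?r (opp k) = opp (?r k)" if "k < n" for k using sym[OF pn(2)[OF that]] rp pr by metis
  have r0: "?r 0 = 0" "?r (opp 0) = opp 0" using rp p0 by metis+
  let ?A = "coord_map n d ?r"
  have A: "?A \<in> G" "?A \<in> LP" using coord_map_LP[OF r r_sym] G_coord by auto
  have "moves_to T (compose Q ?A T')" by (rule moves_to_step[OF T T'(1) A])
  moreover have "compose Q ?A T' x = x" if x: "x \<in> C" for x
  proof -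
    have xQ: "x \<in> Q" using x by (rule corner_in_cube)
    have "?A x = x"
    proof (rule cube_eqI[OF LP_in_cube[OF A(2) xQ] xQ])
      show "?A x ! i = x ! i" if "i < d" for i
        using x that r0 unfolding coord_map_nth[OF xQ that] corners_iff by metis
    qed
    then show ?thesis using xQ fix_C[OF x] by (simp add: compose_nth)
  qed
  moreover have "compose Q ?A T' (pt k 0) = pt k 0" if k: "k < n" for k
  proof -
    have Q: "pt (\<psi> k) 0 \<in> Q" "pt k 0 \<in> Q" using pt_cube pn k n0 by auto
    have "?A (pt (\<psi> k) 0) = pt k 0"
    proof (rule cube_eqI[OF LP_in_cube[OF A(2) Q(1)] Q(2)])
      show "?A (pt (\<psi> k) 0) ! i = pt k 0 ! i" if "i < d" for i
        using r0 rp unfolding coord_map_nth[OF Q(1) that] by (simp add: pt_nth[OF that])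
    qed
    then show ?thesis using Q ax[OF k] by (simp add: compose_nth)
  qed
  ultimately show ?thesis using that by blast
qed

end

theorem theorem4:
  fixes n d :: nat and T :: "nat list \<Rightarrow> nat list"
  assumes "n \<ge> 3" and "d \<ge> 2" and "T \<in> line_perms n d"
  shows "\<exists>A \<in> aut_group n d.
           (\<forall>p \<in> corners n d. compose (cube n d) A T p = p) \<and>
           (\<forall>p \<in> first_axis n d. compose (cube n d) A T p = p)"
proof -
  interpret cube_lines n d using assms by unfold_locales
  obtain T' where T': "moves_to T T'" "\<And>x. x \<in> C \<Longrightarrow> T' x = x" "\<And>k. k < n \<Longrightarrow> T' (pt k 0) = pt k 0"
    using moves_to_fixing[OF assms(3)] by blast
  then obtain A where "A \<in> G" "T' = compose Q A T" by (auto simp: moves_to_def)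
  then show ?thesis using T'(2,3) unfolding first_axis_eq by blast
qed

end
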